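(* There is a universal constant $C>0$ such that the following holds for all integers $d\ge1$, $n_1,n_2\ge2$ and all $\alpha\in(0,1)$, $\beta\in(0,1-\alpha)$. Let $\mathcal{P}^{(d)}_{\rm Multi}$ be the set of pairs $(p_Y,p_Z)$ of probability distributions on $\{1,\dots,d\}$. Let $\mathcal{P}_0=\{(p_Y,p_Z)\in\mathcal{P}^{(d)}_{\rm Multi}:p_Y=p_Z\}$ and $\mathcal{P}_1=\{(p_Y,p_Z)\in\mathcal{P}^{(d)}_{\rm Multi}:\|p_Y-p_Z\|_2\ge\epsilon_{n_1,n_2}\}$, where $$\epsilon_{n_1,n_2}\ \ge\ C\,\frac{b_{(1)}^{1/4}}{\alpha^{1/4}\beta^{1/2}}\Big(\frac1{n_1}+\frac1{n_2}\Big)^{1/2},\qquad b_{(1)}:=\max\{\|p_Y\|_2^2,\|p_Z\|_2^2\}$$ (the separation $\epsilon_{n_1,n_2}$ is allowed to depend on the pair $(p_Y,p_Z)$ through $b_{(1)}$). Then the permutation test based on $U_{n_1,n_2}$ satisfies $$\sup_{P\in\mathcal{P}_0}\mathbb{P}_P(U_{n_1,n_2}>c_{1-\alpha})\le\alpha\quad\text{and}\quad\sup_{P\in\mathcal{P}_1}\mathbb{P}_P(U_{n_1,n_2}\le c_{1-\alpha})\le\beta .$$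
   Context: Data: $Y_1,\dots,Y_{n_1}$ i.i.d. from $p_Y$ and, independently, $Z_1,\dots,Z_{n_2}$ i.i.d. from $p_Z$. Let $g(x,y):=\sum_{k=1}^d\mathbb{1}(x=k)\mathbb{1}(y=k)$, $h_{\rm ts}(y_1,y_2;z_1,z_2):=g(y_1,y_2)+g(z_1,z_2)-g(y_1,z_2)-g(y_2,z_1)$ and $$U_{n_1,n_2}:=\frac{1}{n_1(n_1-1)n_2(n_2-1)}\sum_{i_1\ne i_2}\sum_{j_1\ne j_2}h_{\rm ts}(Y_{i_1},Y_{i_2};Z_{j_1},Z_{j_2}).$$ $\|\cdot\|_2$ is the Euclidean ($\ell_2$) norm of the probability vector. Permutation critical value: let $n=n_1+n_2$ and $(X_1,\dots,X_n)=(Y_1,\dots,Y_{n_1},Z_1,\dots,Z_{n_2})$. For a permutation $\pi$ of $\{1,\dots,n\}$, $U^\pi_{n_1,n_2}$ is the statistic recomputed with $(X_{\pi_1},\dots,X_{\pi_{n_1}})$ as first sample and $(X_{\pi_{n_1+1}},\dots,X_{\pi_n})$ as second sample. Then $c_{1-\alpha}:=\inf\{t:\frac1{n!}\sum_\pi\mathbb{1}(U^\pi_{n_1,n_2}\le t)\ge1-\alpha\}$, and the test rejects when $U_{n_1,n_2}>c_{1-\alpha}$. *)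

theory Defs
  imports "HOL-Probability.Probability" "HOL-Probability.Product_PMF"
begin

definition multi_pairs :: "nat \<Rightarrow> (nat pmf \<times> nat pmf) set" where
  "multi_pairs d = {(pY, pZ). set_pmf pY \<subseteq> {1..d} \<and> set_pmf pZ \<subseteq> {1..d}}"

definition g_multi :: "nat \<Rightarrow> nat \<Rightarrow> nat \<Rightarrow> real" where
  "g_multi d x y = (\<Sum>k=1..d. of_bool (x = k) * of_bool (y = k))"

definition h_ts :: "nat \<Rightarrow> nat \<Rightarrow> nat \<Rightarrow> nat \<Rightarrow> nat \<Rightarrow> real" where
  "h_ts d y1 y2 z1 z2 =
     g_multi d y1 y2 + g_multi d z1 z2 - g_multi d y1 z2 - g_multi d y2 z1"

text \<open>
  Samples are functions on the positive integers; a sample of size \<open>n\<close> uses the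
  indices \<open>1, \<dots>, n\<close> only.
\<close>

definition U_stat :: "nat \<Rightarrow> nat \<Rightarrow> nat \<Rightarrow> (nat \<Rightarrow> nat) \<Rightarrow> (nat \<Rightarrow> nat) \<Rightarrow> real" where
  "U_stat d n1 n2 Y Z =
     1 / (real n1 * (real n1 - 1) * real n2 * (real n2 - 1)) *
     (\<Sum>i1\<in>{1..n1}. \<Sum>i2\<in>{1..n1} - {i1}. \<Sum>j1\<in>{1..n2}. \<Sum>j2\<in>{1..n2} - {j1}.
        h_ts d (Y i1) (Y i2) (Z j1) (Z j2))"

definition pooled :: "nat \<Rightarrow> (nat \<Rightarrow> nat) \<Rightarrow> (nat \<Rightarrow> nat) \<Rightarrow> nat \<Rightarrow> nat" where
  "pooled n1 Y Z i = (if i \<le> n1 then Y i else Z (i - n1))"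

definition U_perm ::
  "nat \<Rightarrow> nat \<Rightarrow> nat \<Rightarrow> (nat \<Rightarrow> nat) \<Rightarrow> (nat \<Rightarrow> nat) \<Rightarrow> (nat \<Rightarrow> nat) \<Rightarrow> real" where
  "U_perm d n1 n2 Y Z \<pi> =
     U_stat d n1 n2 (\<lambda>i. pooled n1 Y Z (\<pi> i)) (\<lambda>j. pooled n1 Y Z (\<pi> (n1 + j)))"

definition crit_value ::
  "nat \<Rightarrow> nat \<Rightarrow> nat \<Rightarrow> real \<Rightarrow> (nat \<Rightarrow> nat) \<Rightarrow> (nat \<Rightarrow> nat) \<Rightarrow> real" where
  "crit_value d n1 n2 \<alpha> Y Z =
     Inf {t. 1 / fact (n1 + n2) *
             (\<Sum>\<pi> | \<pi> permutes {1..n1 + n2}. of_bool (U_perm d n1 n2 Y Z \<pi> \<le> t)) \<ge> 1 - \<alpha>}"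

text \<open>
  Joint law of the two independent i.i.d. samples. The second argument of
  \<^const>\<open>Pi_pmf\<close> is an irrelevant value taken at indices outside the sample.
\<close>

definition sample_law :: "nat \<Rightarrow> nat \<Rightarrow> nat pmf \<times> nat pmf \<Rightarrow> ((nat \<Rightarrow> nat) \<times> (nat \<Rightarrow> nat)) pmf" where
  "sample_law n1 n2 P =
     pair_pmf (Pi_pmf {1..n1} 0 (\<lambda>_. fst P)) (Pi_pmf {1..n2} 0 (\<lambda>_. snd P))"

definition l2_dist :: "nat \<Rightarrow> nat pmf \<times> nat pmf \<Rightarrow> real" where
  "l2_dist d P = L2_set (\<lambda>k. pmf (fst P) k - pmf (snd P) k) {1..d}"

definition b1 :: "nat \<Rightarrow> nat pmf \<times> nat pmf \<Rightarrow> real" where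
  "b1 d P = max ((L2_set (pmf (fst P)) {1..d})\<^sup>2) ((L2_set (pmf (snd P)) {1..d})\<^sup>2)"

definition null_class :: "nat \<Rightarrow> (nat pmf \<times> nat pmf) set" where
  "null_class d = {P \<in> multi_pairs d. fst P = snd P}"

text \<open>The separation \<open>\<epsilon>\<close> may depend on the pair of distributions through \<^const>\<open>b1\<close>.\<close>

definition alt_class :: "nat \<Rightarrow> (real \<Rightarrow> real) \<Rightarrow> (nat pmf \<times> nat pmf) set" where
  "alt_class d \<epsilon> = {P \<in> multi_pairs d. l2_dist d P \<ge> \<epsilon> (b1 d P)}"

end

theory Submission imports Defs begin

text \<open>
  On the pooled sample \<open>x\<close> the statistic is a quadratic form
  \<open>T x = (\<Sum>i j. w i j * of_bool (x i = x j))\<close> whose symmetric weights have zero diagonal and zero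
  row sums. The level is exact by exchangeability: averaging the rejection indicator over all
  permutations leaves the critical value unchanged.

  For the power, let \<open>S\<close> be the sum of the squared weights, \<open>r = 1 / n1 + 1 / n2\<close>, \<open>b\<close> the larger
  squared norm and \<open>m = \<parallel>pY - pZ\<parallel>\<^sup>2\<close>, which is the mean of \<open>T\<close>. Because the row sums vanish, the second
  moment of \<open>T\<close> over all permutations is at most \<open>4 * S\<close> times the probability that two permuted
  positions collide, so it has expectation at most \<open>4 * S * b\<close>; by Markov's inequality the critical
  value exceeds \<open>m / 2\<close> only with probability \<open>O(S * b / (\<alpha> * m\<^sup>2))\<close>. The Hoeffding decomposition of \<open>T\<close>
  bounds its variance by \<open>O(S * b + r * sqrt b * m)\<close>, and Chebyshev's inequality controls
  \<open>T \<le> m / 2\<close>. Since \<open>S \<le> 2 * r\<^sup>2\<close>, both probabilities are small once \<open>m\<close> is a large multiple of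
  \<open>r * sqrt b / (sqrt \<alpha> * \<beta>)\<close>.
\<close>

section \<open>Empirical quantiles of finitely many real values\<close>

text \<open>The point is that the set is bounded below: since \<open>q > 0\<close>, every member
  \<open>t\<close> lies above some value of \<open>f\<close>, hence above the least one. Only then
  does \<open>Inf\<close> carry information.\<close>

lemma quantile_le:
  fixes f :: "'a \<Rightarrow> real"
  assumes "finite P" "P \<noteq> {}" "q > 0" "q \<le> (\<Sum>a\<in>P. of_bool (f a \<le> t)) / real (card P)"
  shows "Inf {t. q \<le> (\<Sum>a\<in>P. of_bool (f a \<le> t)) / real (card P)} \<le> t"
proof (rule cInf_lower)
  show "bdd_below {t. q \<le> (\<Sum>a\<in>P. of_bool (f a \<le> t)) / real (card P)}"
  proof (rule bdd_belowI[of _ "Min (f ` P)"])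
    fix t assume t: "t \<in> {t. q \<le> (\<Sum>a\<in>P. of_bool (f a \<le> t)) / real (card P)}"
    have "\<exists>a\<in>P. f a \<le> t"
    proof (rule ccontr)
      assume "\<not> ?thesis"
      then have "(\<Sum>a\<in>P. of_bool (f a \<le> t)) = (0::real)" by (intro sum.neutral) auto
      with t \<open>q > 0\<close> show False by simp
    qed
    then obtain a where "a \<in> P" "f a \<le> t" by blast
    then show "Min (f ` P) \<le> t" using assms(1) by (meson Min_le finite_imageI image_eqI order_trans)
  qed
qed (use assms in auto)

text \<open>The empirical distribution function is right-continuous because it jumps at finitely
  many points only, so the infimum itself belongs to the set.\<close>

lemma quantile_attained:
  fixes f :: "'a \<Rightarrow> real"
  assumes P: "finite P" "P \<noteq> {}" and q: "q \<le> 1"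
  defines "S \<equiv> {t. q \<le> (\<Sum>a\<in>P. of_bool (f a \<le> t)) / real (card P)}"
  shows "q \<le> (\<Sum>a\<in>P. of_bool (f a \<le> Inf S)) / real (card P)"
proof -
  define c where "c = Inf S"
  have "Max (f ` P) \<in> S"
  proof -
    have "(\<Sum>a\<in>P. of_bool (f a \<le> Max (f ` P))) = (\<Sum>a\<in>P. 1::real)"
      using P by (intro sum.cong) auto
    then show ?thesis unfolding S_def mem_Collect_eq using P q by (simp only:) simp
  qed
  then have ne: "S \<noteq> {}" by blast
  \<comment> \<open>A gap above \<open>c\<close>: no value of \<open>f\<close> lies strictly between
    \<open>c\<close> and \<open>c + \<delta>\<close>, so any \<open>t\<close> below
    \<open>c + \<delta>\<close> counts no more values than \<open>c\<close> does.\<close>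
  have "\<exists>\<delta>>0. \<forall>a\<in>P. c < f a \<longrightarrow> c + \<delta> \<le> f a"
  proof (cases "{a\<in>P. c < f a} = {}")
    case True
    then show ?thesis by (intro exI[of _ 1]) auto
  next
    case False
    define m where "m = Min (f ` {a\<in>P. c < f a})"
    have "m \<in> f ` {a\<in>P. c < f a}" unfolding m_def using False P by (intro Min_in) auto
    then have "c < m" by auto
    moreover have "m \<le> f a" if "a \<in> P" "c < f a" for a
      unfolding m_def using that P by (intro Min_le) auto
    ultimately show ?thesis by (intro exI[of _ "m - c"]) auto
  qed
  then obtain \<delta> where \<delta>: "\<delta> > 0" "\<And>a. a \<in> P \<Longrightarrow> c < f a \<Longrightarrow> c + \<delta> \<le> f a" by blast
  have "\<exists>t\<in>S. t < c + \<delta>"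
    using cInf_lessD[OF ne, of "c + \<delta>"] \<delta>(1) unfolding c_def by auto
  then obtain t where t: "t \<in> S" "t < c + \<delta>" by blast
  have "(\<Sum>a\<in>P. of_bool (f a \<le> t)) \<le> (\<Sum>a\<in>P. of_bool (f a \<le> c) :: real)"
  proof (rule sum_mono)
    fix a assume "a \<in> P"
    then have "f a \<le> c" if "f a \<le> t" using \<delta>(2)[of a] t(2) that by (cases "c < f a") auto
    then show "(of_bool (f a \<le> t) :: real) \<le> of_bool (f a \<le> c)" by auto
  qed
  then have "(\<Sum>a\<in>P. of_bool (f a \<le> t)) / real (card P)
      \<le> (\<Sum>a\<in>P. of_bool (f a \<le> c)) / real (card P)"
    by (rule divide_right_mono) simp
  with t(1) show ?thesis unfolding S_def c_def by simp
qed

section \<open>Quadratic forms with centred weights under permutations\<close>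

text \<open>The symmetric group acts transitively on tuples of distinct points: the complements of
  the two tuples have equal size, so any bijection between them completes the map. This reduces
  permutation moments to one representative per coincidence pattern.\<close>

lemma permutes_extending:
  assumes "finite I" "distinct xs" "distinct ys" "length xs = length ys" "set xs \<subseteq> I" "set ys \<subseteq> I"
  shows "\<exists>\<sigma>. \<sigma> permutes I \<and> map \<sigma> xs = ys"
proof -
  have "card (I - set xs) = card (I - set ys)"
    using assms by (simp add: card_Diff_subset distinct_card)
  then obtain g where g: "bij_betw g (I - set xs) (I - set ys)"
    using finite_same_card_bij[of "I - set xs" "I - set ys"] assms(1) by auto
  define h where "h = (\<lambda>x. the (map_of (zip xs ys) x))"
  have h: "h (xs ! k) = ys ! k" if "k < length xs" for k
    unfolding h_def using that assms by (simp add: map_of_zip_nth)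
  have map_h: "map h xs = ys" using h assms(4) by (intro nth_equalityI) auto
  have "bij_betw h (set xs) (set ys)"
    unfolding bij_betw_def using map_h assms(2,3) by (metis distinct_map set_map)
  then have "bij_betw (\<lambda>x. if x \<in> set xs then h x else g x)
      (set xs \<union> (I - set xs)) (set ys \<union> (I - set ys))"
    using g by (intro bij_betw_disjoint_Un) auto
  then have b: "bij_betw (\<lambda>x. if x \<in> set xs then h x else g x) I I"
    using assms(5,6) by (simp add: Un_absorb1 Un_Diff_cancel)
  define \<sigma> where "\<sigma> = (\<lambda>x. if x \<in> I then if x \<in> set xs then h x else g x else x)"
  have "bij_betw \<sigma> I I" using b by (rule bij_betw_cong[THEN iffD1, rotated]) (simp add: \<sigma>_def)
  then have "\<sigma> permutes I" by (rule bij_imp_permutes) (simp add: \<sigma>_def)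
  moreover have "map \<sigma> xs = ys" 
    using map_h assms(5) by (metis (mono_tags, lifting) \<sigma>_def map_eq_conv subset_code(1))
  ultimately show ?thesis by blast
qed

lemma double_sum_times_double_sum:
  fixes f g :: "'i \<Rightarrow> 'i \<Rightarrow> real"
  shows "(\<Sum>i\<in>I. \<Sum>j\<in>I. f i j) * (\<Sum>k\<in>I. \<Sum>l\<in>I. g k l)
    = (\<Sum>i\<in>I. \<Sum>j\<in>I. \<Sum>k\<in>I. \<Sum>l\<in>I. f i j * g k l)"
  by (simp only: sum_distrib_right) (simp only: sum_distrib_left)

definition collision_form :: "'i set \<Rightarrow> ('i \<Rightarrow> 'i \<Rightarrow> real) \<Rightarrow> ('i \<Rightarrow> 'a) \<Rightarrow> real" where
  "collision_form I w x = (\<Sum>i\<in>I. \<Sum>j\<in>I. w i j * of_bool (x i = x j))"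

locale centred_weights =
  fixes I :: "'i set" and w :: "'i \<Rightarrow> 'i \<Rightarrow> real"
  assumes finite_I: "finite I"
    and diag: "\<And>i. i \<in> I \<Longrightarrow> w i i = 0"
    and sym: "\<And>i j. i \<in> I \<Longrightarrow> j \<in> I \<Longrightarrow> w i j = w j i"
    and row: "\<And>i. i \<in> I \<Longrightarrow> (\<Sum>j\<in>I. w i j) = 0"
begin

lemma column: "j \<in> I \<Longrightarrow> (\<Sum>i\<in>I. w i j) = 0"
  using row[of j] sym by (metis (no_types, lifting) sum.cong)

lemma sum_delta_right:
  fixes f :: "'i \<Rightarrow> real"
  shows "k \<in> I \<Longrightarrow> (\<Sum>l\<in>I. f l * of_bool (k = l)) = f k"
  "k \<in> I \<Longrightarrow> (\<Sum>l\<in>I. f l * of_bool (l = k)) = f k"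
  using finite_I by (simp_all add: of_bool_def if_distrib cong: if_cong)

text \<open>
  The coefficients are the values of a function of \<open>i \<noteq> j\<close>, \<open>k \<noteq> l\<close> that depends only on how many
  indices \<open>{i, j}\<close> and \<open>{k, l}\<close> share: \<open>A\<close> if none, \<open>A + B\<close> if one, \<open>A + 2 B + C\<close> if both.
\<close>

lemma inner_sum_by_overlap:
  assumes ij: "i \<in> I" "j \<in> I"
  shows "(\<Sum>k\<in>I. \<Sum>l\<in>I. w k l *
    (A + B * (of_bool (i = k) + of_bool (i = l) + of_bool (j = k) + of_bool (j = l))
       + C * (of_bool (i = k \<and> j = l) + of_bool (i = l \<and> j = k)))) = 2 * C * w i j"
proof -
  have a: "(\<Sum>k\<in>I. \<Sum>l\<in>I. w k l) = 0" using row by simp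
  have b: "(\<Sum>k\<in>I. \<Sum>l\<in>I. w k l * of_bool (i = k)) = 0" if "i \<in> I" for i
    using row by (simp add: sum_distrib_right[symmetric])
  have c: "(\<Sum>k\<in>I. \<Sum>l\<in>I. w k l * of_bool (i = l)) = 0" if "i \<in> I" for i
    using that column[of i] sum_delta_right by simp
  have d: "(\<Sum>k\<in>I. \<Sum>l\<in>I. w k l * of_bool (i = k \<and> j = l)) = w i j" if "i \<in> I" "j \<in> I" for i j
  proof -
    have "(\<Sum>k\<in>I. \<Sum>l\<in>I. w k l * of_bool (i = k \<and> j = l))
      = (\<Sum>k\<in>I. (\<Sum>l\<in>I. w k l * of_bool (j = l)) * of_bool (i = k))"
      unfolding sum_distrib_right by (intro sum.cong refl) (simp add: of_bool_conj)
    then show ?thesis using that sum_delta_right by simp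
  qed
  have "(\<Sum>k\<in>I. \<Sum>l\<in>I. w k l *
    (A + B * (of_bool (i = k) + of_bool (i = l) + of_bool (j = k) + of_bool (j = l))
       + C * (of_bool (i = k \<and> j = l) + of_bool (i = l \<and> j = k))))
    = A * (\<Sum>k\<in>I. \<Sum>l\<in>I. w k l)
      + B * ((\<Sum>k\<in>I. \<Sum>l\<in>I. w k l * of_bool (i = k)) + (\<Sum>k\<in>I. \<Sum>l\<in>I. w k l * of_bool (i = l))
            + (\<Sum>k\<in>I. \<Sum>l\<in>I. w k l * of_bool (j = k)) + (\<Sum>k\<in>I. \<Sum>l\<in>I. w k l * of_bool (j = l)))
      + C * ((\<Sum>k\<in>I. \<Sum>l\<in>I. w k l * of_bool (i = k \<and> j = l))
            + (\<Sum>k\<in>I. \<Sum>l\<in>I. w k l * of_bool (j = k \<and> i = l)))"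
    unfolding sum_distrib_left sum.distrib[symmetric]
    by (intro sum.cong refl) (auto simp: algebra_simps)
  then show ?thesis using a b c d[of i j] d[of j i] ij sym[of i j] by simp
qed

text \<open>Terms in \<open>A\<close> and \<open>B\<close> constrain at most one summation index in
  each pair, so a free index runs over a full row or column and cancels. Only complete overlap
  survives, once for each of its two orientations.\<close>

lemma sum_by_overlap:
  "(\<Sum>i\<in>I. \<Sum>j\<in>I. \<Sum>k\<in>I. \<Sum>l\<in>I. w i j * w k l *
      (A + B * (of_bool (i = k) + of_bool (i = l) + of_bool (j = k) + of_bool (j = l))
         + C * (of_bool (i = k \<and> j = l) + of_bool (i = l \<and> j = k))))
    = 2 * C * (\<Sum>i\<in>I. \<Sum>j\<in>I. (w i j)\<^sup>2)"
proof -
  have "(\<Sum>i\<in>I. \<Sum>j\<in>I. \<Sum>k\<in>I. \<Sum>l\<in>I. w i j * w k l *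
      (A + B * (of_bool (i = k) + of_bool (i = l) + of_bool (j = k) + of_bool (j = l))
         + C * (of_bool (i = k \<and> j = l) + of_bool (i = l \<and> j = k))))
    = (\<Sum>i\<in>I. \<Sum>j\<in>I. w i j * (2 * C * w i j))"
  proof (intro sum.cong refl)
    fix i j assume "i \<in> I" "j \<in> I"
    from inner_sum_by_overlap[OF this, where A = A and B = B and C = C, symmetric] show "(\<Sum>k\<in>I. \<Sum>l\<in>I. w i j * w k l *
      (A + B * (of_bool (i = k) + of_bool (i = l) + of_bool (j = k) + of_bool (j = l))
         + C * (of_bool (i = k \<and> j = l) + of_bool (i = l \<and> j = k)))) = w i j * (2 * C * w i j)"
      by (simp only: sum_distrib_left mult.assoc)
  qed
  also have "\<dots> = 2 * C * (\<Sum>i\<in>I. \<Sum>j\<in>I. (w i j)\<^sup>2)"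
    by (simp add: sum_distrib_left power2_eq_square mult_ac)
  finally show ?thesis .
qed

text \<open>Expanding the square leaves joint collision counts \<open>F i j k l\<close>. Averaging
  over all permutations makes them depend only on the overlap of the two pairs, which is the
  situation of \<open>sum_by_overlap\<close>.\<close>

lemma permutation_second_moment:
  fixes x :: "'i \<Rightarrow> 'a"
  assumes "card I \<ge> 4" and ab: "a \<in> I" "b \<in> I" "a \<noteq> b"
  shows "(\<Sum>\<pi> | \<pi> permutes I. (collision_form I w (x \<circ> \<pi>))\<^sup>2)
    \<le> 4 * (\<Sum>i\<in>I. \<Sum>j\<in>I. (w i j)\<^sup>2) * (\<Sum>\<pi> | \<pi> permutes I. of_bool (x (\<pi> a) = x (\<pi> b)))"
proof -
  let ?P = "{\<pi>. \<pi> permutes I}"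
  define F where "F i j k l =
    (\<Sum>\<pi>\<in>?P. of_bool (x (\<pi> i) = x (\<pi> j)) * of_bool (x (\<pi> k) = x (\<pi> l)) :: real)" for i j k l
  \<comment> \<open>Two further points \<open>c\<close> and \<open>e\<close> complete
    \<open>a\<close>, \<open>b\<close> to a representative of the pattern of four distinct
    indices.\<close>
  have "card (I - {a, b}) \<ge> 2" using assms finite_I by (simp add: card_Diff_subset)
  then obtain c where c: "c \<in> I" "c \<notin> {a, b}"
    by (metis Diff_iff card.empty ex_in_conv not_numeral_le_zero)
  have "card {a, b, c} = 3" using ab c by auto
  then have "card (I - {a, b, c}) \<ge> 1"
    using assms c finite_I by (subst card_Diff_subset) auto
  then obtain e where e: "e \<in> I" "e \<notin> {a, b, c}"
    by (metis Diff_iff card.empty ex_in_conv not_one_le_zero)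
  have inv: "F (\<sigma> i) (\<sigma> j) (\<sigma> k) (\<sigma> l) = F i j k l" if "\<sigma> permutes I" for \<sigma> i j k l
    unfolding F_def by (subst (2) sum_permutations_compose_right[OF that]) simp
  have swap: "F i j k l = F j i k l" "F i j k l = F i j l k" for i j k l
    unfolding F_def by (simp_all add: eq_commute)
  have F0: "F i j k l = F a b c e"
    if "i \<in> I" "j \<in> I" "k \<in> I" "l \<in> I" "distinct [i, j, k, l]" for i j k l
  proof -
    have "\<exists>\<sigma>. \<sigma> permutes I \<and> map \<sigma> [a, b, c, e] = [i, j, k, l]"
      by (rule permutes_extending[OF finite_I]) (use that ab c e in auto)
    then obtain \<sigma> where "\<sigma> permutes I" "map \<sigma> [a, b, c, e] = [i, j, k, l]" by (elim exE conjE)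
    then show ?thesis using inv[of \<sigma> a b c e] by simp
  qed
  have F1: "F i j i l = F a b a c" if "i \<in> I" "j \<in> I" "l \<in> I" "distinct [i, j, l]" for i j l
  proof -
    have "\<exists>\<sigma>. \<sigma> permutes I \<and> map \<sigma> [a, b, c] = [i, j, l]"
      by (rule permutes_extending[OF finite_I]) (use that ab c e in auto)
    then obtain \<sigma> where "\<sigma> permutes I" "map \<sigma> [a, b, c] = [i, j, l]" by (elim exE conjE)
    then show ?thesis using inv[of \<sigma> a b a c] by simp
  qed
  have F2: "F i j i j = F a b a b" if "i \<in> I" "j \<in> I" "i \<noteq> j" for i j
  proof -
    have "\<exists>\<sigma>. \<sigma> permutes I \<and> map \<sigma> [a, b] = [i, j]"
      by (rule permutes_extending[OF finite_I]) (use that ab in auto)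
    then obtain \<sigma> where "\<sigma> permutes I" "map \<sigma> [a, b] = [i, j]" by (elim exE conjE)
    then show ?thesis using inv[of \<sigma> a b a b] by simp
  qed
  \<comment> \<open>The index is the number of distinct positions involved. The coefficients below
    solve \<open>A = M4\<close>, \<open>A + B = M3\<close>,
    \<open>A + 2 * B + C = M2\<close>.\<close>
  define M4 M3 M2 where "M4 = F a b c e" and "M3 = F a b a c" and "M2 = F a b a b"
  have F: "F i j k l = M4
      + (M3 - M4) * (of_bool (i = k) + of_bool (i = l) + of_bool (j = k) + of_bool (j = l))
      + (M2 - 2 * M3 + M4) * (of_bool (i = k \<and> j = l) + of_bool (i = l \<and> j = k))"
    if I: "i \<in> I" "j \<in> I" "k \<in> I" "l \<in> I" and ne: "i \<noteq> j" "k \<noteq> l" for i j k l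
  proof -
    consider "i = k" "j = l" | "i = l" "j = k" | "i = k" "j \<noteq> l" | "i = l" "j \<noteq> k"
      | "j = k" "i \<noteq> l" | "j = l" "i \<noteq> k" | "distinct [i, j, k, l]"
      using ne by auto
    then show ?thesis
    proof cases
      case 1
      with F2[of i j] I ne show ?thesis by (simp add: M2_def)
    next
      case 2
      with F2[of i j] I ne swap(2)[of i j k l] show ?thesis by (simp add: M2_def)
    next
      case 3
      with F1[of i j l] I ne show ?thesis by (auto simp: M3_def)
    next
      case 4
      with F1[of i j k] I ne swap(2)[of i j k l] show ?thesis by (auto simp: M3_def)
    next
      case 5
      with F1[of j i l] I ne swap(1)[of i j k l] show ?thesis by (auto simp: M3_def)
    next
      case 6
      with F1[of j i k] I ne swap(1)[of i j k l] swap(2)[of j i k l] show ?thesis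
        by (auto simp: M3_def)
    next
      case 7
      with F0[of i j k l] I show ?thesis by (auto simp: M4_def)
    qed
  qed
  have sq: "(collision_form I w (x \<circ> \<pi>))\<^sup>2 = (\<Sum>i\<in>I. \<Sum>j\<in>I. \<Sum>k\<in>I. \<Sum>l\<in>I. w i j * w k l *
      (of_bool (x (\<pi> i) = x (\<pi> j)) * of_bool (x (\<pi> k) = x (\<pi> l))))" for \<pi>
    unfolding collision_form_def power2_eq_square o_def
    by (simp only: double_sum_times_double_sum, intro sum.cong refl, simp add: mult_ac)
  have "(\<Sum>\<pi>\<in>?P. (collision_form I w (x \<circ> \<pi>))\<^sup>2)
      = (\<Sum>i\<in>I. \<Sum>j\<in>I. \<Sum>k\<in>I. \<Sum>l\<in>I. w i j * w k l * F i j k l)"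
    unfolding sq F_def sum_distrib_left by (simp only: sum.swap[where A = ?P and B = I])
  also have "\<dots> = (\<Sum>i\<in>I. \<Sum>j\<in>I. \<Sum>k\<in>I. \<Sum>l\<in>I. w i j * w k l * (M4
      + (M3 - M4) * (of_bool (i = k) + of_bool (i = l) + of_bool (j = k) + of_bool (j = l))
      + (M2 - 2 * M3 + M4) * (of_bool (i = k \<and> j = l) + of_bool (i = l \<and> j = k))))"
  proof (intro sum.cong refl)
    fix i j k l assume I: "i \<in> I" "j \<in> I" "k \<in> I" "l \<in> I"
    show "w i j * w k l * F i j k l = w i j * w k l * (M4
      + (M3 - M4) * (of_bool (i = k) + of_bool (i = l) + of_bool (j = k) + of_bool (j = l))
      + (M2 - 2 * M3 + M4) * (of_bool (i = k \<and> j = l) + of_bool (i = l \<and> j = k)))"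
    \<comment> \<open>The overlap formula covers proper pairs only; degenerate pairs carry zero
      weight by \<open>diag\<close>.\<close>
    proof (cases "i = j \<or> k = l")
      case True
      then have "w i j * w k l = 0" using diag I by auto
      then show ?thesis by (simp only: mult_zero_left)
    next
      case False
      then have "i \<noteq> j" "k \<noteq> l" by auto
      from F[OF I this] show ?thesis by (rule arg_cong)
    qed
  qed
  also have "\<dots> = 2 * (M2 - 2 * M3 + M4) * (\<Sum>i\<in>I. \<Sum>j\<in>I. (w i j)\<^sup>2)"
    by (rule sum_by_overlap)
  also have "\<dots> \<le> 2 * (2 * M2) * (\<Sum>i\<in>I. \<Sum>j\<in>I. (w i j)\<^sup>2)"
  proof (rule mult_right_mono)
    \<comment> \<open>The term with \<open>M3\<close> enters negatively and is dropped;
      \<open>M4 \<le> M2\<close> because a product of indicators is at most its first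
      factor.\<close>
    have "M3 \<ge> 0" unfolding M3_def F_def by (intro sum_nonneg) auto
    moreover have "M4 \<le> M2" unfolding M4_def M2_def F_def by (intro sum_mono) auto
    ultimately show "2 * (M2 - 2 * M3 + M4) \<le> 2 * (2 * M2)" by simp
    show "0 \<le> (\<Sum>i\<in>I. \<Sum>j\<in>I. (w i j)\<^sup>2)" by (intro sum_nonneg) auto
  qed
  also have "M2 = (\<Sum>\<pi>\<in>?P. of_bool (x (\<pi> a) = x (\<pi> b)))"
    unfolding M2_def F_def by (intro sum.cong refl) simp
  finally show ?thesis by (simp add: o_def mult_ac)
qed

end

section \<open>Finite product laws and the centred collision kernel\<close>

text \<open>Finite supports make every real function of the sample integrable, so linearity and
  monotonicity of \<open>E\<close> carry no side conditions.\<close>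

locale finite_product_pmf =
  fixes I :: "'i set" and dflt :: 'a and p :: "'i \<Rightarrow> 'a pmf"
  assumes finite_index: "finite I"
    and finite_set: "\<And>i. i \<in> I \<Longrightarrow> finite (set_pmf (p i))"
begin

abbreviation E :: "(('i \<Rightarrow> 'a) \<Rightarrow> real) \<Rightarrow> real" where
  "E \<equiv> measure_pmf.expectation (Pi_pmf I dflt p)"

lemma finite_set_Pi: "finite (set_pmf (Pi_pmf I dflt p))"
  using finite_index finite_set by (simp add: set_Pi_pmf finite_PiE_dflt)

lemma integrable_Pi [simp]: "integrable (measure_pmf (Pi_pmf I dflt p)) (f :: _ \<Rightarrow> real)"
  using finite_set_Pi by (rule integrable_measure_pmf_finite)

lemma integrable_coordinate: "i \<in> I \<Longrightarrow> integrable (measure_pmf (p i)) (f :: _ \<Rightarrow> real)"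
  using finite_set by (intro integrable_measure_pmf_finite)

lemma E_mono: "(\<And>x. f x \<le> g x) \<Longrightarrow> E f \<le> E g"
  by (intro integral_mono) auto

text \<open>A one-coordinate Fubini principle: redrawing coordinate \<open>i\<close> independently
  preserves the product law. The independence arguments below all integrate out one coordinate this
  way.\<close>

lemma Pi_pmf_resample:
  assumes "i \<in> I"
  shows "Pi_pmf I dflt p = Pi_pmf I dflt p \<bind> (\<lambda>x. map_pmf (\<lambda>y. x(i := y)) (p i))"
proof -
  have I: "I = insert i (I - {i})" using assms by auto
  have "Pi_pmf I dflt p = p i \<bind> (\<lambda>y. Pi_pmf (I - {i}) dflt p \<bind> (\<lambda>f. return_pmf (f(i := y))))"
    by (subst I, subst Pi_pmf_insert') (use finite_index in auto)
  then show ?thesis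
    by (simp add: map_pmf_def bind_assoc_pmf bind_return_pmf bind_commute_pmf[of "p i"])
qed

lemma E_resample:
  assumes "i \<in> I"
  shows "E f = E (\<lambda>x. measure_pmf.expectation (p i) (\<lambda>y. f (x(i := y))))"
proof -
  have "E f = (\<Sum>x\<in>set_pmf (Pi_pmf I dflt p).
      pmf (Pi_pmf I dflt p) x * measure_pmf.expectation (map_pmf (\<lambda>y. x(i := y)) (p i)) f)"
    by (subst Pi_pmf_resample[OF assms], subst pmf_expectation_bind[OF finite_set_Pi])
      (use finite_set[OF assms] in auto)
  also have "\<dots> = E (\<lambda>x. measure_pmf.expectation (p i) (\<lambda>y. f (x(i := y))))"
    by (subst integral_measure_pmf[OF finite_set_Pi]) auto
  finally show ?thesis .
qed

lemma E_coordinate: "i \<in> I \<Longrightarrow> E (\<lambda>x. f (x i)) = measure_pmf.expectation (p i) f"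
  by (subst E_resample) auto

lemma E_pair:
  assumes "i \<in> I" "j \<in> I" "i \<noteq> j"
  shows "E (\<lambda>x. f (x i) (x j))
    = measure_pmf.expectation (p j) (\<lambda>z. measure_pmf.expectation (p i) (\<lambda>y. f y z))"
  using assms E_coordinate[of j "\<lambda>z. measure_pmf.expectation (p i) (\<lambda>y. f y z)"]
  by (subst E_resample[of i]) simp_all

text \<open>Additivity of variance for independent centred summands; the mixed products vanish by
  \<open>E_pair\<close>.\<close>

lemma E_square_sum:
  assumes "\<And>i. i \<in> I \<Longrightarrow> measure_pmf.expectation (p i) (a i) = 0"
  shows "E (\<lambda>x. (\<Sum>i\<in>I. a i (x i))\<^sup>2) = (\<Sum>i\<in>I. measure_pmf.expectation (p i) (\<lambda>y. (a i y)\<^sup>2))"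
proof -
  have "E (\<lambda>x. (\<Sum>i\<in>I. a i (x i))\<^sup>2) = (\<Sum>i\<in>I. \<Sum>j\<in>I. E (\<lambda>x. a i (x i) * a j (x j)))"
    by (simp add: power2_eq_square sum_product)
  also have "\<dots> = (\<Sum>i\<in>I. \<Sum>j\<in>I. of_bool (j = i) * measure_pmf.expectation (p i) (\<lambda>y. (a i y)\<^sup>2))"
  proof (intro sum.cong refl)
    fix i j assume ij: "i \<in> I" "j \<in> I"
    show "E (\<lambda>x. a i (x i) * a j (x j)) = of_bool (j = i) * measure_pmf.expectation (p i) (\<lambda>y. (a i y)\<^sup>2)"
    proof (cases "j = i")
      case True
      with E_coordinate[of i "\<lambda>y. (a i y)\<^sup>2"] ij show ?thesis by (simp add: power2_eq_square)
    next
      case False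
      with E_pair[of i j "\<lambda>y z. a i y * a j z"] ij assms show ?thesis by simp
    qed
  qed
  also have "\<dots> = (\<Sum>i\<in>I. measure_pmf.expectation (p i) (\<lambda>y. (a i y)\<^sup>2))"
  proof (intro sum.cong refl)
    fix i assume "i \<in> I"
    then show "(\<Sum>j\<in>I. of_bool (j = i) * measure_pmf.expectation (p i) (\<lambda>y. (a i y)\<^sup>2))
      = measure_pmf.expectation (p i) (\<lambda>y. (a i y)\<^sup>2)"
      using finite_index by (simp flip: sum_distrib_right)
  qed
  finally show ?thesis .
qed

text \<open>The inner product of two mass functions, written as an expectation so that no range of
  summation has to be fixed. For distinct positions it is their collision probability.\<close>

definition overlap :: "'i \<Rightarrow> 'i \<Rightarrow> real" where
  "overlap i j = measure_pmf.expectation (p i) (pmf (p j))"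

lemma overlap_sym:
  assumes "i \<in> I" "j \<in> I"
  shows "overlap i j = overlap j i"
proof -
  have *: "overlap i j = (\<Sum>a\<in>set_pmf (p i) \<union> set_pmf (p j). pmf (p i) a * pmf (p j) a)"
    if "i \<in> I" "j \<in> I" for i j
    unfolding overlap_def by (subst integral_measure_pmf) (use finite_set that in auto)
  show ?thesis using *[of i j] *[of j i] assms by (simp add: Un_commute mult.commute)
qed

lemma overlap_nonneg: "0 \<le> overlap i j"
  unfolding overlap_def by (intro integral_nonneg_AE) simp

lemma overlap_le_1: "i \<in> I \<Longrightarrow> overlap i j \<le> 1"
proof -
  assume i: "i \<in> I"
  have "overlap i j \<le> measure_pmf.expectation (p i) (\<lambda>_. 1)"
    unfolding overlap_def using integrable_coordinate[OF i] by (intro integral_mono) (auto simp: pmf_le_1)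
  then show ?thesis by simp
qed

lemma expectation_point: "measure_pmf.expectation q (\<lambda>y. of_bool (y = b)) = pmf q b"
proof -
  have "(\<lambda>y. of_bool (y = b)) = (indicator {b} :: _ \<Rightarrow> real)" by (auto simp: indicator_def)
  then show ?thesis by (simp add: measure_pmf_single)
qed

lemma E_collision:
  assumes "i \<in> I" "j \<in> I" "i \<noteq> j"
  shows "E (\<lambda>x. of_bool (x i = x j)) = overlap i j"
  using E_pair[of i j "\<lambda>y z. of_bool (y = z)"] assms overlap_sym
  by (simp add: expectation_point overlap_def)

text \<open>The degenerate part of the Hoeffding decomposition of the collision kernel.\<close>

definition centred_kernel :: "'i \<Rightarrow> 'i \<Rightarrow> 'a \<Rightarrow> 'a \<Rightarrow> real" where
  "centred_kernel i j y z = of_bool (y = z) - pmf (p i) z - pmf (p j) y + overlap i j"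

lemma centred_kernel_sym:
  "i \<in> I \<Longrightarrow> j \<in> I \<Longrightarrow> centred_kernel i j y z = centred_kernel j i z y"
  unfolding centred_kernel_def using overlap_sym by (auto simp: eq_commute)

lemma expectation_centred_kernel:
  assumes "i \<in> I"
  shows "measure_pmf.expectation (p i) (\<lambda>y. centred_kernel i j y z) = 0"
  using integrable_coordinate[OF assms]
  by (simp add: centred_kernel_def expectation_point overlap_def[symmetric])

text \<open>Cauchy-Schwarz for four terms, followed by \<open>u\<^sup>2 \<le> u\<close> on the unit
  interval. Removing the squares leaves terms that all have mean \<open>overlap i j\<close>.\<close>

lemma centred_kernel_square_le:
  assumes "i \<in> I"
  shows "(centred_kernel i j y z)\<^sup>2 \<le> 4 * (of_bool (y = z) + pmf (p i) z + pmf (p j) y + overlap i j)"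
proof -
  have *: "(a - b - c + d)\<^sup>2 \<le> 4 * (a + b + c + d)"
    if "0 \<le> a" "a \<le> 1" "0 \<le> b" "b \<le> 1" "0 \<le> c" "c \<le> 1" "0 \<le> d" "d \<le> 1" for a b c d :: real
  proof -
    have "(a - b - c + d)\<^sup>2 \<le> 4 * (a\<^sup>2 + b\<^sup>2 + c\<^sup>2 + d\<^sup>2)"
    proof -
      \<comment> \<open>Lagrange's identity: the defect in Cauchy-Schwarz is the sum of the six
        squared differences of the signed terms \<open>a\<close>, \<open>- b\<close>,
        \<open>- c\<close>, \<open>d\<close>.\<close>
      have "4 * (a\<^sup>2 + b\<^sup>2 + c\<^sup>2 + d\<^sup>2) - (a - b - c + d)\<^sup>2
        = (a + b)\<^sup>2 + (a + c)\<^sup>2 + (a - d)\<^sup>2 + (b - c)\<^sup>2 + (b + d)\<^sup>2 + (c + d)\<^sup>2"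
        by (simp add: power2_eq_square algebra_simps)
      moreover have "\<dots> \<ge> 0" by simp
      ultimately show ?thesis by linarith
    qed
    moreover have "u\<^sup>2 \<le> u" if "0 \<le> u" "u \<le> 1" for u :: real
      using that by (simp add: power2_eq_square mult_left_le)
    ultimately show ?thesis using that by (smt (verit))
  qed
  show ?thesis unfolding centred_kernel_def
    by (rule *) (use overlap_nonneg overlap_le_1[OF assms] in \<open>auto simp: pmf_le_1\<close>)
qed

text \<open>Four terms of equal mean in the pointwise bound, each with factor 4, give 16.\<close>

lemma E_centred_kernel_square:
  assumes "i \<in> I" "j \<in> I" "i \<noteq> j"
  shows "E (\<lambda>x. (centred_kernel i j (x i) (x j))\<^sup>2) \<le> 16 * overlap i j"
proof -
  have "E (\<lambda>x. (centred_kernel i j (x i) (x j))\<^sup>2)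
    \<le> E (\<lambda>x. 4 * (of_bool (x i = x j) + pmf (p i) (x j) + pmf (p j) (x i) + overlap i j))"
    using centred_kernel_square_le[OF assms(1)] by (intro E_mono) auto
  also have "\<dots> = 16 * overlap i j"
    using E_coordinate[of i "pmf (p j)"] E_coordinate[of j "pmf (p i)"] E_collision[of i j]
      overlap_sym[of i j] assms by (simp add: overlap_def[symmetric])
  finally show ?thesis .
qed

text \<open>Coordinate \<open>i\<close> occurs in the first factor only, and integrating it out
  annihilates that factor by degeneracy of the kernel.\<close>

lemma E_centred_kernel_product_eq_0:
  assumes "i \<in> I" "j \<in> I" "i \<noteq> j" "i \<notin> {k, l}"
  shows "E (\<lambda>x. centred_kernel i j (x i) (x j) * centred_kernel k l (x k) (x l)) = 0"
  using assms by (subst E_resample[of i]) (auto simp: expectation_centred_kernel)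

end

section \<open>Hoeffding decomposition and variance of the form\<close>

locale weighted_product_pmf = finite_product_pmf I dflt p + centred_weights I w
  for I :: "'i set" and dflt :: 'a and p :: "'i \<Rightarrow> 'a pmf" and w
begin

text \<open>Centred kernels on pairs that do not coincide as sets are uncorrelated, so only complete
  overlap contributes. The constant is 2 orientations times 16 from
  \<open>E_centred_kernel_square\<close>.\<close>

lemma E_degenerate_part_square:
  assumes b: "\<And>i j. i \<in> I \<Longrightarrow> j \<in> I \<Longrightarrow> overlap i j \<le> b"
  shows "E (\<lambda>x. (\<Sum>i\<in>I. \<Sum>j\<in>I. w i j * centred_kernel i j (x i) (x j))\<^sup>2)
    \<le> 32 * b * (\<Sum>i\<in>I. \<Sum>j\<in>I. (w i j)\<^sup>2)"
proof -
  define q where "q = (\<lambda>i j (x :: 'i \<Rightarrow> 'a). centred_kernel i j (x i) (x j))"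
  define V where "V = (\<lambda>i j. E (\<lambda>x. (q i j x)\<^sup>2))"
  have q_sym: "q i j x = q j i x" if "i \<in> I" "j \<in> I" for i j x
    unfolding q_def using that by (rule centred_kernel_sym)
  \<comment> \<open>The literal zeros put the covariance in the shape of
    \<open>inner_sum_by_overlap\<close> with \<open>A = B = 0\<close>. The inner version is the
    right one because the coefficient \<open>V i j\<close> varies with the pair.\<close>
  have cov: "E (\<lambda>x. q i j x * q k l x)
      = 0 + 0 * (of_bool (i = k) + of_bool (i = l) + of_bool (j = k) + of_bool (j = l))
         + V i j * (of_bool (i = k \<and> j = l) + of_bool (i = l \<and> j = k))"
    if I: "i \<in> I" "j \<in> I" "k \<in> I" "l \<in> I" and ne: "i \<noteq> j" "k \<noteq> l" for i j k l
  proof -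
    consider "i = k" "j = l" | "i = l" "j = k" | "i \<notin> {k, l}" | "j \<notin> {k, l}" using ne by auto
    then show ?thesis
    proof cases
      case 1
      then show ?thesis using ne by (simp add: V_def power2_eq_square)
    next
      case 2
      then show ?thesis using ne I q_sym[of k l] by (simp add: V_def power2_eq_square)
    next
      case 3
      then have "E (\<lambda>x. q i j x * q k l x) = 0"
        unfolding q_def using E_centred_kernel_product_eq_0 I ne by blast
      with 3 show ?thesis by auto
    next
      case 4
      then have "E (\<lambda>x. q j i x * q k l x) = 0"
        unfolding q_def using E_centred_kernel_product_eq_0 I ne by blast
      with 4 show ?thesis using q_sym[OF I(1,2)] by auto
    qed
  qed
  have "E (\<lambda>x. (\<Sum>i\<in>I. \<Sum>j\<in>I. w i j * q i j x)\<^sup>2)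
    = (\<Sum>i\<in>I. \<Sum>j\<in>I. \<Sum>k\<in>I. \<Sum>l\<in>I. w i j * w k l * E (\<lambda>x. q i j x * q k l x))"
  proof -
    have "w i j * q i j x * (w k l * q k l x) = w i j * w k l * (q i j x * q k l x)" for i j k l x
      by simp
    then show ?thesis
      by (simp only: power2_eq_square double_sum_times_double_sum) simp
  qed
  also have "\<dots> = (\<Sum>i\<in>I. \<Sum>j\<in>I. w i j * (\<Sum>k\<in>I. \<Sum>l\<in>I. w k l *
      (0 + 0 * (of_bool (i = k) + of_bool (i = l) + of_bool (j = k) + of_bool (j = l))
         + V i j * (of_bool (i = k \<and> j = l) + of_bool (i = l \<and> j = k)))))"
    unfolding sum_distrib_left
  proof (intro sum.cong refl)
    fix i j k l assume I: "i \<in> I" "j \<in> I" "k \<in> I" "l \<in> I"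
    show "w i j * w k l * E (\<lambda>x. q i j x * q k l x) = w i j * (w k l *
      (0 + 0 * (of_bool (i = k) + of_bool (i = l) + of_bool (j = k) + of_bool (j = l))
         + V i j * (of_bool (i = k \<and> j = l) + of_bool (i = l \<and> j = k))))"
    proof (cases "i = j \<or> k = l")
      case True
      then have "w i j = 0 \<or> w k l = 0" using diag I by auto
      then show ?thesis by (elim disjE) (simp_all only: mult_zero_left mult_zero_right)
    next
      case False
      then have "i \<noteq> j" "k \<noteq> l" by auto
      from cov[OF I this] show ?thesis by (simp only: mult.assoc)
    qed
  qed
  also have "\<dots> = (\<Sum>i\<in>I. \<Sum>j\<in>I. w i j * (2 * V i j * w i j))"
    by (intro sum.cong refl arg_cong2[where f = times] inner_sum_by_overlap) auto
  also have "\<dots> \<le> (\<Sum>i\<in>I. \<Sum>j\<in>I. 32 * b * (w i j)\<^sup>2)"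
  proof (intro sum_mono)
    fix i j assume I: "i \<in> I" "j \<in> I"
    show "w i j * (2 * V i j * w i j) \<le> 32 * b * (w i j)\<^sup>2"
    proof (cases "i = j")
      case True
      then show ?thesis using diag I by simp
    next
      case False
      then have "V i j \<le> 16 * b"
        using E_centred_kernel_square[OF I] b[OF I] unfolding V_def q_def by linarith
      then have "2 * V i j * (w i j)\<^sup>2 \<le> 2 * (16 * b) * (w i j)\<^sup>2"
        by (intro mult_right_mono) auto
      then show ?thesis by (simp add: power2_eq_square mult_ac)
    qed
  qed
  finally show ?thesis unfolding q_def by (simp add: sum_distrib_left)
qed

definition mean_form :: real where
  "mean_form = (\<Sum>i\<in>I. \<Sum>j\<in>I. w i j * overlap i j)"

text \<open>The conditional mean of row \<open>i\<close> of the form given \<open>x i = y\<close>,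
  that is, the linear term of the Hoeffding decomposition. The index \<open>j = i\<close> adds
  nothing since the diagonal weights vanish.\<close>

definition projection :: "'i \<Rightarrow> 'a \<Rightarrow> real" where
  "projection i y = (\<Sum>j\<in>I. w i j * pmf (p j) y)"

lemma expectation_projection:
  "i \<in> I \<Longrightarrow> measure_pmf.expectation (p i) (projection i) = (\<Sum>j\<in>I. w i j * overlap i j)"
  unfolding projection_def overlap_def using integrable_coordinate by simp

lemma variance_le_second_moment:
  fixes f :: "'a \<Rightarrow> real"
  assumes "i \<in> I"
  shows "measure_pmf.expectation (p i) (\<lambda>y. (f y - measure_pmf.expectation (p i) f)\<^sup>2)
    \<le> measure_pmf.expectation (p i) (\<lambda>y. (f y)\<^sup>2)"
proof -
  have "measure_pmf.expectation (p i) (\<lambda>y. (f y - measure_pmf.expectation (p i) f)\<^sup>2)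
    = measure_pmf.expectation (p i) (\<lambda>y. (f y)\<^sup>2) - (measure_pmf.expectation (p i) f)\<^sup>2"
    by (rule measure_pmf.variance_eq) (intro integrable_coordinate assms)+
  then show ?thesis by simp
qed

text \<open>The Hoeffding decomposition, as an identity valid for every sample. The factor 2 appears
  because symmetry of \<open>w\<close> makes the two linear sums equal.\<close>

lemma collision_form_decomposition:
  "collision_form I w x - mean_form =
    (\<Sum>i\<in>I. \<Sum>j\<in>I. w i j * centred_kernel i j (x i) (x j))
    + 2 * (\<Sum>i\<in>I. projection i (x i) - measure_pmf.expectation (p i) (projection i))"
proof -
  have "(\<Sum>i\<in>I. \<Sum>j\<in>I. w i j * pmf (p i) (x j)) = (\<Sum>j\<in>I. \<Sum>i\<in>I. w j i * pmf (p i) (x j))"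
    by (subst sum.swap) (use sym in \<open>auto intro!: sum.cong\<close>)
  then have 1: "(\<Sum>i\<in>I. \<Sum>j\<in>I. w i j * pmf (p i) (x j)) = (\<Sum>i\<in>I. projection i (x i))"
    by (simp add: projection_def)
  have 2: "(\<Sum>i\<in>I. \<Sum>j\<in>I. w i j * pmf (p j) (x i)) = (\<Sum>i\<in>I. projection i (x i))"
    by (simp add: projection_def)
  have 3: "(\<Sum>i\<in>I. measure_pmf.expectation (p i) (projection i)) = mean_form"
    unfolding mean_form_def by (intro sum.cong refl expectation_projection)
  have "(\<Sum>i\<in>I. \<Sum>j\<in>I. w i j * centred_kernel i j (x i) (x j))
    = collision_form I w x - (\<Sum>i\<in>I. \<Sum>j\<in>I. w i j * pmf (p i) (x j))
      - (\<Sum>i\<in>I. \<Sum>j\<in>I. w i j * pmf (p j) (x i)) + mean_form"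
    unfolding collision_form_def mean_form_def centred_kernel_def
      sum_subtractf[symmetric] sum.distrib[symmetric]
    by (intro sum.cong refl) (simp add: algebra_simps)
  then show ?thesis using 1 2 3 by (simp add: sum_subtractf)
qed

text \<open>The elementary bound \<open>sq\<close> avoids the covariance of the two parts at the
  price of doubling: 64 is twice 32. Each centred projection is then bounded by its raw second
  moment.\<close>

lemma collision_form_variance:
  assumes b: "\<And>i j. i \<in> I \<Longrightarrow> j \<in> I \<Longrightarrow> overlap i j \<le> b"
  shows "E (\<lambda>x. (collision_form I w x - mean_form)\<^sup>2)
    \<le> 64 * b * (\<Sum>i\<in>I. \<Sum>j\<in>I. (w i j)\<^sup>2)
      + 8 * (\<Sum>i\<in>I. measure_pmf.expectation (p i) (\<lambda>y. (projection i y)\<^sup>2))"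
proof -
  let ?Q = "\<lambda>x. \<Sum>i\<in>I. \<Sum>j\<in>I. w i j * centred_kernel i j (x i) (x j)"
  let ?a = "\<lambda>i y. projection i y - measure_pmf.expectation (p i) (projection i)"
  let ?L = "\<lambda>x. \<Sum>i\<in>I. ?a i (x i)"
  have sq: "(q + 2 * l)\<^sup>2 \<le> 2 * q\<^sup>2 + 8 * l\<^sup>2" for q l :: real
  proof -
    have "2 * q\<^sup>2 + 8 * l\<^sup>2 - (q + 2 * l)\<^sup>2 = (q - 2 * l)\<^sup>2"
      by (simp add: power2_eq_square algebra_simps)
    then show ?thesis by (metis diff_ge_0_iff_ge zero_le_power2)
  qed
  have "E (\<lambda>x. (collision_form I w x - mean_form)\<^sup>2) \<le> E (\<lambda>x. 2 * (?Q x)\<^sup>2 + 8 * (?L x)\<^sup>2)"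
    unfolding collision_form_decomposition by (intro E_mono sq)
  also have "\<dots> = 2 * E (\<lambda>x. (?Q x)\<^sup>2) + 8 * E (\<lambda>x. (?L x)\<^sup>2)"
    by simp
  also have "E (\<lambda>x. (?L x)\<^sup>2) = (\<Sum>i\<in>I. measure_pmf.expectation (p i) (\<lambda>y. (?a i y)\<^sup>2))"
    by (rule E_square_sum) (simp add: integrable_coordinate)
  also have "\<dots> \<le> (\<Sum>i\<in>I. measure_pmf.expectation (p i) (\<lambda>y. (projection i y)\<^sup>2))"
    by (intro sum_mono variance_le_second_moment)
  finally show ?thesis using E_degenerate_part_square[OF b] by simp
qed

end

section \<open>Permutation critical values\<close>

definition permutation_quantile ::
    "'i set \<Rightarrow> (('i \<Rightarrow> 'a) \<Rightarrow> real) \<Rightarrow> real \<Rightarrow> ('i \<Rightarrow> 'a) \<Rightarrow> real" where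
  "permutation_quantile I T q x =
    Inf {t. q \<le> (\<Sum>\<pi> | \<pi> permutes I. of_bool (T (x \<circ> \<pi>) \<le> t)) / real (card {\<pi>. \<pi> permutes I})}"

lemma permutations_nonempty: "{\<pi>. \<pi> permutes I} \<noteq> {}"
  using permutes_id by blast

text \<open>As \<open>\<pi>\<close> runs over all permutations, so does its composition with
  \<open>\<sigma>\<close>; the critical value depends only on the orbit of the sample.\<close>

lemma permutation_quantile_invariant:
  assumes "\<sigma> permutes I"
  shows "permutation_quantile I T q (x \<circ> \<sigma>) = permutation_quantile I T q x"
proof -
  have "(\<Sum>\<pi> | \<pi> permutes I. of_bool (T (x \<circ> \<sigma> \<circ> \<pi>) \<le> t))
      = (\<Sum>\<pi> | \<pi> permutes I. of_bool (T (x \<circ> \<pi>) \<le> t) :: real)" for t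
    by (subst (2) setum_permutations_compose_left[OF assms]) (simp add: o_assoc)
  then show ?thesis by (simp only: permutation_quantile_def)
qed

lemma sum_of_bool_less:
  fixes f :: "'a \<Rightarrow> real"
  shows "(\<Sum>a\<in>P. of_bool (t < f a)) = real (card P) - (\<Sum>a\<in>P. of_bool (f a \<le> t))"
proof -
  have "(\<Sum>a\<in>P. of_bool (t < f a)) = (\<Sum>a\<in>P. 1 - of_bool (f a \<le> t) :: real)"
    by (intro sum.cong) auto
  then show ?thesis by (simp only: sum_subtractf) simp
qed

text \<open>The level in deterministic form, for one fixed sample. It rests on the infimum being
  attained.\<close>

lemma permutation_exceedance_le:
  fixes T :: "('i \<Rightarrow> 'a) \<Rightarrow> real"
  assumes "finite I" "0 < \<alpha>"
  shows "(\<Sum>\<pi> | \<pi> permutes I. of_bool (permutation_quantile I T (1 - \<alpha>) x < T (x \<circ> \<pi>)))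
    \<le> \<alpha> * real (card {\<pi>. \<pi> permutes I})"
proof -
  let ?P = "{\<pi>. \<pi> permutes I}"
  have fin: "finite ?P" using assms(1) by (rule finite_permutations)
  then have pos: "0 < real (card ?P)" using permutations_nonempty by (simp add: card_gt_0_iff)
  have "1 - \<alpha> \<le> (\<Sum>\<pi>\<in>?P. of_bool (T (x \<circ> \<pi>) \<le> permutation_quantile I T (1 - \<alpha>) x)) / real (card ?P)"
    unfolding permutation_quantile_def
    by (rule quantile_attained[OF fin permutations_nonempty]) (use assms(2) in simp)
  then show ?thesis using pos by (simp only: sum_of_bool_less) (simp add: field_simps)
qed

text \<open>Markov's inequality for the square of the statistic under the uniform law on
  permutations.\<close>

lemma permutation_quantile_le:
  fixes T :: "('i \<Rightarrow> 'a) \<Rightarrow> real"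
  assumes "finite I" "0 < \<alpha>" "\<alpha> < 1" "0 < t"
    and "(\<Sum>\<pi> | \<pi> permutes I. (T (x \<circ> \<pi>))\<^sup>2) \<le> \<alpha> * t\<^sup>2 * real (card {\<pi>. \<pi> permutes I})"
  shows "permutation_quantile I T (1 - \<alpha>) x \<le> t"
proof -
  let ?P = "{\<pi>. \<pi> permutes I}"
  have fin: "finite ?P" using assms(1) by (rule finite_permutations)
  then have pos: "0 < real (card ?P)" using permutations_nonempty by (simp add: card_gt_0_iff)
  have "t\<^sup>2 * (\<Sum>\<pi>\<in>?P. of_bool (t < T (x \<circ> \<pi>))) \<le> (\<Sum>\<pi>\<in>?P. (T (x \<circ> \<pi>))\<^sup>2)"
    unfolding sum_distrib_left using assms(4) by (intro sum_mono) (auto simp: power_mono)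
  then have "t\<^sup>2 * (\<Sum>\<pi>\<in>?P. of_bool (t < T (x \<circ> \<pi>))) \<le> t\<^sup>2 * (\<alpha> * real (card ?P))"
    using assms(5) by (simp only: mult_ac)
  then have "(\<Sum>\<pi>\<in>?P. of_bool (t < T (x \<circ> \<pi>))) \<le> \<alpha> * real (card ?P)"
    using assms(4) by (simp only: mult_le_cancel_left_pos zero_less_power)
  then have "1 - \<alpha> \<le> (\<Sum>\<pi>\<in>?P. of_bool (T (x \<circ> \<pi>) \<le> t)) / real (card ?P)"
    using pos by (simp only: sum_of_bool_less) (simp add: field_simps)
  then show ?thesis unfolding permutation_quantile_def
    by (intro quantile_le fin permutations_nonempty) (use assms(3) in auto)
qed

text \<open>
  If the test accepts, then either \<open>T x \<le> m / 2\<close> or the critical value exceeds \<open>m / 2\<close>. The second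
  alternative forces a large second moment under permutations.
\<close>

lemma acceptance_indicator_le:
  fixes T :: "('i \<Rightarrow> 'a) \<Rightarrow> real"
  assumes "finite I" "0 < \<alpha>" "\<alpha> < 1" "0 < m"
  shows "of_bool (T x \<le> permutation_quantile I T (1 - \<alpha>) x)
    \<le> 4 / m\<^sup>2 * (T x - m)\<^sup>2
      + 4 / (\<alpha> * m\<^sup>2 * real (card {\<pi>. \<pi> permutes I})) * (\<Sum>\<pi> | \<pi> permutes I. (T (x \<circ> \<pi>))\<^sup>2)"
    (is "_ \<le> ?A + ?B")
proof -
  let ?P = "{\<pi>. \<pi> permutes I}"
  have fin: "finite ?P" using assms(1) by (rule finite_permutations)
  then have pos: "0 < real (card ?P)" using permutations_nonempty by (simp add: card_gt_0_iff)
  have nn: "0 \<le> ?A" "0 \<le> ?B"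
    using assms by (auto intro!: divide_nonneg_nonneg mult_nonneg_nonneg sum_nonneg)
  consider "T x \<le> m / 2" | "m / 2 < permutation_quantile I T (1 - \<alpha>) x"
    | "\<not> T x \<le> permutation_quantile I T (1 - \<alpha>) x" by linarith
  then show ?thesis
  proof cases
    case 1
    then have "(m / 2)\<^sup>2 \<le> (m - T x)\<^sup>2" using assms by (intro power_mono) auto
    then have "1 \<le> ?A" using assms by (simp add: field_simps power2_commute)
    then have "1 \<le> ?A + ?B" using nn by linarith
    then show ?thesis by (rule order_trans[rotated]) simp
  next
    case 2
    then have "\<alpha> * (m / 2)\<^sup>2 * real (card ?P) < (\<Sum>\<pi>\<in>?P. (T (x \<circ> \<pi>))\<^sup>2)"
      using permutation_quantile_le[of I \<alpha> "m / 2" T x] assms by force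
    then have "1 \<le> ?B" using assms pos by (simp add: field_simps)
    then have "1 \<le> ?A + ?B" using nn by linarith
    then show ?thesis by (rule order_trans[rotated]) simp
  next
    case 3
    with nn show ?thesis by simp
  qed
qed

section \<open>Level and type II error of the permutation test\<close>

context finite_product_pmf
begin

lemma prob_eq_E: "measure_pmf.prob (Pi_pmf I dflt p) {x. R x} = E (\<lambda>x. of_bool (R x))"
proof -
  have "(\<lambda>x. of_bool (R x)) = (indicator {x. R x} :: _ \<Rightarrow> real)" by (auto simp: indicator_def)
  then show ?thesis by simp
qed

text \<open>Under exchangeability the rejection probability equals its average over all permuted
  samples, and that average is controlled sample by sample.\<close>

lemma permutation_test_level:
  assumes "\<And>i. i \<in> I \<Longrightarrow> p i = q" "0 < \<alpha>"
  shows "measure_pmf.prob (Pi_pmf I dflt p) {x. permutation_quantile I T (1 - \<alpha>) x < T x} \<le> \<alpha>"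
proof -
  let ?P = "{\<pi>. \<pi> permutes I}"
  let ?R = "\<lambda>x. permutation_quantile I T (1 - \<alpha>) x < T x"
  have fin: "finite ?P" using finite_index by (rule finite_permutations)
  then have pos: "0 < real (card ?P)" using permutations_nonempty by (simp add: card_gt_0_iff)
  have const: "Pi_pmf I dflt p = Pi_pmf I dflt (\<lambda>_. q)" using assms by (intro Pi_pmf_cong) auto
  have exchangeable: "E (\<lambda>x. of_bool (?R x)) = E (\<lambda>x. of_bool (?R (x \<circ> \<pi>)))" if "\<pi> permutes I" for \<pi>
  proof -
    have "Pi_pmf I dflt p = map_pmf (\<lambda>x. x \<circ> \<pi>) (Pi_pmf I dflt p)"
      unfolding const using that finite_index
      by (intro Pi_pmf_bij_betw) (auto simp: permutes_imp_bij permutes_in_image)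
    then have "E (\<lambda>x. of_bool (?R x))
      = measure_pmf.expectation (map_pmf (\<lambda>x. x \<circ> \<pi>) (Pi_pmf I dflt p)) (\<lambda>x. of_bool (?R x))"
      by (rule arg_cong)
    then show ?thesis by simp
  qed
  have "real (card ?P) * E (\<lambda>x. of_bool (?R x)) = (\<Sum>\<pi>\<in>?P. E (\<lambda>x. of_bool (?R (x \<circ> \<pi>))))"
  proof -
    have "(\<Sum>\<pi>\<in>?P. E (\<lambda>x. of_bool (?R (x \<circ> \<pi>)))) = (\<Sum>\<pi>\<in>?P. E (\<lambda>x. of_bool (?R x)))"
      by (intro sum.cong refl exchangeable[symmetric]) simp
    then show ?thesis by simp
  qed
  also have "\<dots> = E (\<lambda>x. \<Sum>\<pi>\<in>?P. of_bool (?R (x \<circ> \<pi>)))"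
    by (subst Bochner_Integration.integral_sum) auto
  \<comment> \<open>By invariance all permuted samples share one threshold, so the sum counts
    exceedances of a fixed number.\<close>
  also have "\<dots> = E (\<lambda>x. \<Sum>\<pi>\<in>?P. of_bool (permutation_quantile I T (1 - \<alpha>) x < T (x \<circ> \<pi>)))"
    by (intro arg_cong[of _ _ E] ext sum.cong refl) (auto simp: permutation_quantile_invariant)
  also have "\<dots> \<le> E (\<lambda>x. \<alpha> * real (card ?P))"
    using permutation_exceedance_le finite_index assms by (intro E_mono) blast
  finally have "E (\<lambda>x. of_bool (?R x)) \<le> \<alpha>" using pos by (simp add: mult.commute)
  then show ?thesis by (simp only: prob_eq_E)
qed

end

context weighted_product_pmf
begin

text \<open>Take expectations in \<open>acceptance_indicator_le\<close>. The first term is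
  Chebyshev's inequality with the Hoeffding variance bound. In the second, a permutation maps a
  fixed pair to two distinct positions, whose collision probability is at most \<open>b\<close>;
  hence \<open>16 = 4 * 4\<close>.\<close>

lemma permutation_test_type_II:
  assumes "card I \<ge> 4" "0 < \<alpha>" "\<alpha> < 1" "0 < mean_form"
    and b: "\<And>i j. i \<in> I \<Longrightarrow> j \<in> I \<Longrightarrow> overlap i j \<le> b"
  defines "S \<equiv> \<Sum>i\<in>I. \<Sum>j\<in>I. (w i j)\<^sup>2"
    and "V \<equiv> \<Sum>i\<in>I. measure_pmf.expectation (p i) (\<lambda>y. (projection i y)\<^sup>2)"
  shows "measure_pmf.prob (Pi_pmf I dflt p)
      {x. collision_form I w x \<le> permutation_quantile I (collision_form I w) (1 - \<alpha>) x}
    \<le> 4 / mean_form\<^sup>2 * (64 * b * S + 8 * V) + 16 * b * S / (\<alpha> * mean_form\<^sup>2)"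
proof -
  let ?P = "{\<pi>. \<pi> permutes I}"
  let ?T = "collision_form I w"
  define m where "m = mean_form"
  have "0 < m" using assms by (simp add: m_def)
  have fin: "finite ?P" using finite_index by (rule finite_permutations)
  then have pos: "0 < real (card ?P)" using permutations_nonempty by (simp add: card_gt_0_iff)
  obtain u v where uv: "u \<in> I" "v \<in> I" "u \<noteq> v"
    using assms(1) by (metis card_le_Suc0_iff_eq finite_index numeral_le_one_iff
        le_trans One_nat_def semiring_norm(69))
  have S: "0 \<le> S" unfolding S_def by (intro sum_nonneg) auto
  have "E (\<lambda>x. \<Sum>\<pi>\<in>?P. (?T (x \<circ> \<pi>))\<^sup>2)
    \<le> E (\<lambda>x. 4 * S * (\<Sum>\<pi>\<in>?P. of_bool (x (\<pi> u) = x (\<pi> v))))"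
    unfolding S_def by (intro E_mono permutation_second_moment assms(1) uv)
  also have "\<dots> = 4 * S * (\<Sum>\<pi>\<in>?P. E (\<lambda>x. of_bool (x (\<pi> u) = x (\<pi> v))))"
    by simp
  also have "\<dots> \<le> 4 * S * (\<Sum>\<pi>\<in>?P. b)"
  proof (intro mult_left_mono sum_mono)
    fix \<pi> assume "\<pi> \<in> ?P"
    then have \<pi>: "\<pi> permutes I" by simp
    then have "\<pi> u \<in> I" "\<pi> v \<in> I" "\<pi> u \<noteq> \<pi> v"
      using uv by (auto simp: permutes_in_image dest: permutes_inj[THEN injD])
    then show "E (\<lambda>x. of_bool (x (\<pi> u) = x (\<pi> v))) \<le> b"
      using E_collision b by simp
  qed (use S in auto)
  finally have W: "E (\<lambda>x. \<Sum>\<pi>\<in>?P. (?T (x \<circ> \<pi>))\<^sup>2) \<le> 4 * S * b * real (card ?P)"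
    by (simp add: mult_ac)
  have "E (\<lambda>x. of_bool (?T x \<le> permutation_quantile I ?T (1 - \<alpha>) x))
    \<le> E (\<lambda>x. 4 / m\<^sup>2 * (?T x - m)\<^sup>2
      + 4 / (\<alpha> * m\<^sup>2 * real (card ?P)) * (\<Sum>\<pi>\<in>?P. (?T (x \<circ> \<pi>))\<^sup>2))"
    by (intro E_mono acceptance_indicator_le finite_index assms(2,3) \<open>0 < m\<close>)
  also have "\<dots> = 4 / m\<^sup>2 * E (\<lambda>x. (?T x - m)\<^sup>2)
      + 4 / (\<alpha> * m\<^sup>2 * real (card ?P)) * E (\<lambda>x. \<Sum>\<pi>\<in>?P. (?T (x \<circ> \<pi>))\<^sup>2)"
    by simp
  also have "\<dots> \<le> 4 / m\<^sup>2 * (64 * b * S + 8 * V)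
      + 4 / (\<alpha> * m\<^sup>2 * real (card ?P)) * (4 * S * b * real (card ?P))"
    using W collision_form_variance[OF b] assms(2)
    by (intro add_mono mult_left_mono) (auto simp: S_def V_def m_def)
  also have "\<dots> = 4 / m\<^sup>2 * (64 * b * S + 8 * V) + 16 * b * S / (\<alpha> * m\<^sup>2)"
    using pos by simp
  finally show ?thesis by (simp only: prob_eq_E m_def)
qed

end

section \<open>The two-sample statistic as a centred quadratic form\<close>

lemma sum_two_samples:
  fixes f :: "nat \<Rightarrow> real"
  shows "(\<Sum>i=1..n1 + n2. f i) = (\<Sum>i=1..n1. f i) + (\<Sum>j=1..n2. f (n1 + j))"
  by (induction n2) (simp_all add: add.assoc)

lemma sum_off_diagonal:
  fixes f :: "'i \<Rightarrow> real"
  assumes "finite A"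
  shows "(\<Sum>i\<in>A. \<Sum>j\<in>A - {i}. f i) = (real (card A) - 1) * (\<Sum>i\<in>A. f i)"
    and "(\<Sum>i\<in>A. \<Sum>j\<in>A - {i}. f j) = (real (card A) - 1) * (\<Sum>i\<in>A. f i)"
proof -
  have row: "(\<Sum>j\<in>A - {i}. f i) = (real (card A) - 1) * f i" if "i \<in> A" for i
  proof -
    have "card A \<ge> 1" using that assms by (auto simp: Suc_le_eq card_gt_0_iff)
    then show ?thesis using that assms by (simp add: card_Diff_singleton of_nat_diff)
  qed
  show "(\<Sum>i\<in>A. \<Sum>j\<in>A - {i}. f i) = (real (card A) - 1) * (\<Sum>i\<in>A. f i)"
    unfolding sum_distrib_left by (intro sum.cong refl row)
  have "(\<Sum>i\<in>A. \<Sum>j\<in>A - {i}. f j) = (\<Sum>i\<in>A. (\<Sum>j\<in>A. f j) - f i)"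
    using assms by (intro sum.cong refl) (simp add: sum_diff1)
  then show "(\<Sum>i\<in>A. \<Sum>j\<in>A - {i}. f j) = (real (card A) - 1) * (\<Sum>i\<in>A. f i)"
    by (simp add: sum_subtractf algebra_simps)
qed

text \<open>Counting multiplicities: a pair from one sample recurs once for every ordered pair from
  the other, while each of the two cross terms leaves one index of each sample free.\<close>

lemma sum_four_fold:
  fixes f :: "'i \<Rightarrow> 'i \<Rightarrow> real" and h :: "'j \<Rightarrow> 'j \<Rightarrow> real" and u :: "'i \<Rightarrow> 'j \<Rightarrow> real"
  assumes A: "finite A" and B: "finite B"
  defines "a \<equiv> real (card A)" and "b \<equiv> real (card B)"
  shows "(\<Sum>i\<in>A. \<Sum>i'\<in>A - {i}. \<Sum>j\<in>B. \<Sum>j'\<in>B - {j}. f i i' + h j j' - u i j' - u i' j)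
    = b * (b - 1) * (\<Sum>i\<in>A. \<Sum>i'\<in>A - {i}. f i i') + a * (a - 1) * (\<Sum>j\<in>B. \<Sum>j'\<in>B - {j}. h j j')
      - 2 * (a - 1) * (b - 1) * (\<Sum>i\<in>A. \<Sum>j\<in>B. u i j)"
proof -
  define H where "H = (\<Sum>j\<in>B. \<Sum>j'\<in>B - {j}. h j j')"
  define U where "U i = (\<Sum>j\<in>B. u i j)" for i
  have inner: "(\<Sum>j\<in>B. \<Sum>j'\<in>B - {j}. f i i' + h j j' - u i j' - u i' j)
      = b * (b - 1) * f i i' + H - (b - 1) * U i - (b - 1) * U i'" for i i'
  proof -
    have "(\<Sum>j\<in>B. \<Sum>j'\<in>B - {j}. f i i' + h j j' - u i j' - u i' j)
      = (\<Sum>j\<in>B. \<Sum>j'\<in>B - {j}. f i i') + H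
        - (\<Sum>j\<in>B. \<Sum>j'\<in>B - {j}. u i j') - (\<Sum>j\<in>B. \<Sum>j'\<in>B - {j}. u i' j)"
      by (simp only: sum_subtractf sum.distrib H_def)
    also have "(\<Sum>j\<in>B. \<Sum>j'\<in>B - {j}. f i i') = b * (b - 1) * f i i'"
      by (subst sum_off_diagonal(1)[OF B]) (simp add: b_def)
    also have "(\<Sum>j\<in>B. \<Sum>j'\<in>B - {j}. u i j') = (b - 1) * U i"
      by (subst sum_off_diagonal(2)[OF B]) (simp add: b_def U_def)
    also have "(\<Sum>j\<in>B. \<Sum>j'\<in>B - {j}. u i' j) = (b - 1) * U i'"
      by (subst sum_off_diagonal(1)[OF B]) (simp add: b_def U_def)
    finally show ?thesis .
  qed
  have "(\<Sum>i\<in>A. \<Sum>i'\<in>A - {i}. b * (b - 1) * f i i' + H - (b - 1) * U i - (b - 1) * U i')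
    = (\<Sum>i\<in>A. \<Sum>i'\<in>A - {i}. b * (b - 1) * f i i') + (\<Sum>i\<in>A. \<Sum>i'\<in>A - {i}. H)
      - (\<Sum>i\<in>A. \<Sum>i'\<in>A - {i}. (b - 1) * U i) - (\<Sum>i\<in>A. \<Sum>i'\<in>A - {i}. (b - 1) * U i')"
    by (simp only: sum_subtractf sum.distrib)
  also have "(\<Sum>i\<in>A. \<Sum>i'\<in>A - {i}. H) = a * (a - 1) * H"
    by (subst sum_off_diagonal(1)[OF A]) (simp add: a_def)
  also have "(\<Sum>i\<in>A. \<Sum>i'\<in>A - {i}. (b - 1) * U i) = (a - 1) * ((b - 1) * (\<Sum>i\<in>A. U i))"
    by (subst sum_off_diagonal(1)[OF A]) (simp add: a_def sum_distrib_left)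
  also have "(\<Sum>i\<in>A. \<Sum>i'\<in>A - {i}. (b - 1) * U i') = (a - 1) * ((b - 1) * (\<Sum>i\<in>A. U i))"
    by (subst sum_off_diagonal(2)[OF A]) (simp add: a_def sum_distrib_left)
  also have "(\<Sum>i\<in>A. \<Sum>i'\<in>A - {i}. b * (b - 1) * f i i')
      = b * (b - 1) * (\<Sum>i\<in>A. \<Sum>i'\<in>A - {i}. f i i')"
    by (simp only: sum_distrib_left)
  finally have "(\<Sum>i\<in>A. \<Sum>i'\<in>A - {i}. b * (b - 1) * f i i' + H - (b - 1) * U i - (b - 1) * U i')
    = b * (b - 1) * (\<Sum>i\<in>A. \<Sum>i'\<in>A - {i}. f i i') + a * (a - 1) * H
      - (a - 1) * ((b - 1) * (\<Sum>i\<in>A. U i)) - (a - 1) * ((b - 1) * (\<Sum>i\<in>A. U i))" .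
  then show ?thesis
    unfolding inner by (simp only: H_def[symmetric] U_def[symmetric])
qed

text \<open>The coefficients of \<open>sum_four_fold\<close> after normalisation; the cross
  coefficient \<open>- 2 / (n1 * n2)\<close> is split evenly between \<open>(i, j)\<close> and
  \<open>(j, i)\<close> to make the weights symmetric.\<close>

definition two_sample_weight :: "nat \<Rightarrow> nat \<Rightarrow> nat \<Rightarrow> nat \<Rightarrow> real" where
  "two_sample_weight n1 n2 i j =
    (if i = j then 0
     else if i \<le> n1 \<and> j \<le> n1 then 1 / (real n1 * (real n1 - 1))
     else if n1 < i \<and> n1 < j then 1 / (real n2 * (real n2 - 1))
     else - 1 / (real n1 * real n2))"

text \<open>The function \<open>F\<close> is arbitrary because rows are later paired with constants,
  with the weights themselves, with collision indicators and with mass functions.\<close>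

lemma row_first_sample:
  assumes "i \<in> {1..n1}"
  shows "(\<Sum>j=1..n1 + n2. two_sample_weight n1 n2 i j * F j)
    = 1 / (real n1 * (real n1 - 1)) * (\<Sum>j\<in>{1..n1} - {i}. F j)
      - 1 / (real n1 * real n2) * (\<Sum>j=1..n2. F (n1 + j))"
proof -
  have "(\<Sum>j=1..n1. two_sample_weight n1 n2 i j * F j)
    = (\<Sum>j\<in>{1..n1} - {i}. 1 / (real n1 * (real n1 - 1)) * F j)"
    using assms by (subst sum.remove[of _ i]) (auto simp: two_sample_weight_def intro!: sum.cong)
  moreover have "(\<Sum>j=1..n2. two_sample_weight n1 n2 i (n1 + j) * F (n1 + j))
    = (\<Sum>j=1..n2. - (1 / (real n1 * real n2) * F (n1 + j)))"
    using assms by (intro sum.cong) (auto simp: two_sample_weight_def)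
  ultimately show ?thesis
    unfolding sum_two_samples by (simp only: sum_distrib_left sum_negf)
qed

lemma row_second_sample:
  assumes "k \<in> {1..n2}"
  shows "(\<Sum>j=1..n1 + n2. two_sample_weight n1 n2 (n1 + k) j * F j)
    = 1 / (real n2 * (real n2 - 1)) * (\<Sum>j\<in>{1..n2} - {k}. F (n1 + j))
      - 1 / (real n1 * real n2) * (\<Sum>j=1..n1. F j)"
proof -
  have "(\<Sum>j=1..n2. two_sample_weight n1 n2 (n1 + k) (n1 + j) * F (n1 + j))
    = (\<Sum>j\<in>{1..n2} - {k}. 1 / (real n2 * (real n2 - 1)) * F (n1 + j))"
    using assms by (subst sum.remove[of _ k]) (auto simp: two_sample_weight_def intro!: sum.cong)
  moreover have "(\<Sum>j=1..n1. two_sample_weight n1 n2 (n1 + k) j * F j)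
    = (\<Sum>j=1..n1. - (1 / (real n1 * real n2) * F j))"
    using assms by (intro sum.cong) (auto simp: two_sample_weight_def)
  ultimately show ?thesis
    unfolding sum_two_samples by (simp only: sum_distrib_left sum_negf)
qed

lemma centred_two_sample_weight:
  assumes "n1 \<ge> 2" "n2 \<ge> 2"
  shows "centred_weights {1..n1 + n2} (two_sample_weight n1 n2)"
proof
  fix i assume i: "i \<in> {1..n1 + n2}"
  show "(\<Sum>j=1..n1 + n2. two_sample_weight n1 n2 i j) = 0"
  proof (cases "i \<le> n1")
    case True
    then show ?thesis using row_first_sample[of i n1 n2 "\<lambda>_. 1"] i assms
      by (simp add: of_nat_diff)
  next
    case False
    then obtain k where "i = n1 + k" "k \<in> {1..n2}"
      using i by (intro that[of "i - n1"]) auto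
    then show ?thesis using row_second_sample[of k n2 n1 "\<lambda>_. 1"] assms
      by (simp add: of_nat_diff)
  qed
qed (auto simp: two_sample_weight_def)

text \<open>The sum equals \<open>1 / (a * (a - 1)) + 1 / (b * (b - 1)) + 2 / (a * b)\<close>
  exactly, found by applying the row formulas with the weights as \<open>F\<close>.\<close>

lemma sum_square_two_sample_weight_le:
  assumes "n1 \<ge> 2" "n2 \<ge> 2"
  shows "(\<Sum>i=1..n1 + n2. \<Sum>j=1..n1 + n2. (two_sample_weight n1 n2 i j)\<^sup>2)
    \<le> 2 * (1 / real n1 + 1 / real n2)\<^sup>2"
proof -
  define a b where "a = real n1" and "b = real n2"
  have ab: "a \<ge> 2" "b \<ge> 2" using assms by (auto simp: a_def b_def)
  have first: "(\<Sum>j=1..n1 + n2. (two_sample_weight n1 n2 i j)\<^sup>2) = (1 / (a * (a - 1)) + 1 / (a * b)) / a"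
    if "i \<in> {1..n1}" for i
  proof -
    have "(\<Sum>j\<in>{1..n1} - {i}. two_sample_weight n1 n2 i j) = (\<Sum>j\<in>{1..n1} - {i}. 1 / (a * (a - 1)))"
      using that by (intro sum.cong) (auto simp: two_sample_weight_def a_def)
    moreover have "(\<Sum>j=1..n2. two_sample_weight n1 n2 i (n1 + j)) = (\<Sum>j=1..n2. - 1 / (a * b))"
      using that by (intro sum.cong) (auto simp: two_sample_weight_def a_def b_def)
    ultimately have "(\<Sum>j=1..n1 + n2. (two_sample_weight n1 n2 i j)\<^sup>2)
      = 1 / (a * (a - 1)) * ((a - 1) * (1 / (a * (a - 1)))) - 1 / (a * b) * (b * (- 1 / (a * b)))"
      using row_first_sample[OF that, of n2 "two_sample_weight n1 n2 i"] that assms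
      by (simp add: power2_eq_square a_def b_def of_nat_diff)
    also have "\<dots> = (1 / (a * (a - 1)) + 1 / (a * b)) / a"
    proof -
      have "(a - 1) * (1 / (a * (a - 1))) = 1 / a" "b * (- 1 / (a * b)) = - 1 / a" using ab by simp_all
      then show ?thesis by (simp only:) (simp add: add_divide_distrib mult_ac)
    qed
    finally show ?thesis .
  qed
  have second: "(\<Sum>j=1..n1 + n2. (two_sample_weight n1 n2 (n1 + k) j)\<^sup>2)
      = (1 / (b * (b - 1)) + 1 / (a * b)) / b"
    if "k \<in> {1..n2}" for k
  proof -
    have "(\<Sum>j\<in>{1..n2} - {k}. two_sample_weight n1 n2 (n1 + k) (n1 + j))
      = (\<Sum>j\<in>{1..n2} - {k}. 1 / (b * (b - 1)))"
      using that by (intro sum.cong) (auto simp: two_sample_weight_def b_def)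
    moreover have "(\<Sum>j=1..n1. two_sample_weight n1 n2 (n1 + k) j) = (\<Sum>j=1..n1. - 1 / (a * b))"
      using that by (intro sum.cong) (auto simp: two_sample_weight_def a_def b_def)
    ultimately have "(\<Sum>j=1..n1 + n2. (two_sample_weight n1 n2 (n1 + k) j)\<^sup>2)
      = 1 / (b * (b - 1)) * ((b - 1) * (1 / (b * (b - 1)))) - 1 / (a * b) * (a * (- 1 / (a * b)))"
      using row_second_sample[OF that, of n1 "two_sample_weight n1 n2 (n1 + k)"] that assms
      by (simp add: power2_eq_square a_def b_def of_nat_diff)
    also have "\<dots> = (1 / (b * (b - 1)) + 1 / (a * b)) / b"
    proof -
      have "(b - 1) * (1 / (b * (b - 1))) = 1 / b" "a * (- 1 / (a * b)) = - 1 / b" using ab by simp_all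
      then show ?thesis by (simp only:) (simp add: add_divide_distrib mult_ac)
    qed
    finally show ?thesis .
  qed
  have "(\<Sum>i=1..n1 + n2. \<Sum>j=1..n1 + n2. (two_sample_weight n1 n2 i j)\<^sup>2)
    = (\<Sum>i=1..n1. (1 / (a * (a - 1)) + 1 / (a * b)) / a) + (\<Sum>k=1..n2. (1 / (b * (b - 1)) + 1 / (a * b)) / b)"
    unfolding sum_two_samples[where f = "\<lambda>i. \<Sum>j=1..n1 + n2. (two_sample_weight n1 n2 i j)\<^sup>2"]
    by (intro arg_cong2[where f = "(+)"] sum.cong refl first second)
  also have "\<dots> = 1 / (a * (a - 1)) + 1 / (b * (b - 1)) + 2 / (a * b)"
    using ab by (simp flip: a_def b_def)
  also have "\<dots> \<le> 2 * (1 / a)\<^sup>2 + 2 * (1 / b)\<^sup>2 + 4 * (1 / a) * (1 / b)"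
  proof -
    \<comment> \<open>This is \<open>u - 1 \<ge> u / 2\<close>, where the sample sizes being at
      least 2 enters.\<close>
    have *: "1 / (u * (u - 1)) \<le> 2 * (1 / u)\<^sup>2" if "u \<ge> 2" for u :: real
      using that by (simp add: field_simps power2_eq_square)
    have "2 / (a * b) \<le> 4 * (1 / a) * (1 / b)" using ab by (simp add: field_simps)
    with *[OF ab(1)] *[OF ab(2)] show ?thesis by linarith
  qed
  also have "\<dots> = 2 * (1 / a + 1 / b)\<^sup>2"
    by (simp add: power2_eq_square algebra_simps)
  finally show ?thesis by (simp add: a_def b_def)
qed

lemma g_multi_eq: "a \<in> {1..d} \<Longrightarrow> g_multi d a b = of_bool (a = b)"
proof -
  assume a: "a \<in> {1..d}"
  have "g_multi d a b = (\<Sum>k=1..d. if k = a then of_bool (b = a) else 0)"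
    unfolding g_multi_def by (intro sum.cong) auto
  then show ?thesis using a by auto
qed

lemma U_stat_eq_collision_form:
  assumes n: "n1 \<ge> 2" "n2 \<ge> 2" and x: "\<And>i. i \<in> {1..n1 + n2} \<Longrightarrow> x i \<in> {1..d}"
  shows "U_stat d n1 n2 x (\<lambda>j. x (n1 + j)) = collision_form {1..n1 + n2} (two_sample_weight n1 n2) x"
proof -
  let ?K = "\<lambda>i j. of_bool (x i = x j) :: real"
  define a b where "a = real n1" and "b = real n2"
  have ab: "a \<ge> 2" "b \<ge> 2" using n by (auto simp: a_def b_def)
  define F where "F = (\<Sum>i=1..n1. \<Sum>j\<in>{1..n1} - {i}. ?K i j)"
  define H where "H = (\<Sum>i=1..n2. \<Sum>j\<in>{1..n2} - {i}. ?K (n1 + i) (n1 + j))"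
  define W where "W = (\<Sum>i=1..n1. \<Sum>j=1..n2. ?K i (n1 + j))"
  have "(\<Sum>i1\<in>{1..n1}. \<Sum>i2\<in>{1..n1} - {i1}. \<Sum>j1\<in>{1..n2}. \<Sum>j2\<in>{1..n2} - {j1}.
      h_ts d (x i1) (x i2) (x (n1 + j1)) (x (n1 + j2)))
    = (\<Sum>i1\<in>{1..n1}. \<Sum>i2\<in>{1..n1} - {i1}. \<Sum>j1\<in>{1..n2}. \<Sum>j2\<in>{1..n2} - {j1}.
      ?K i1 i2 + ?K (n1 + j1) (n1 + j2) - ?K i1 (n1 + j2) - ?K i2 (n1 + j1))"
  proof (intro sum.cong refl)
    fix i1 i2 j1 j2
    assume "i1 \<in> {1..n1}" "i2 \<in> {1..n1} - {i1}" "j1 \<in> {1..n2}" "j2 \<in> {1..n2} - {j1}"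
    \<comment> \<open>These are the values that occur as first arguments of \<open>g_multi\<close>
      in \<open>h_ts\<close>, as \<open>g_multi_eq\<close> requires.\<close>
    then have "x i1 \<in> {1..d}" "x i2 \<in> {1..d}" "x (n1 + j1) \<in> {1..d}" by (intro x; force)+
    then show "h_ts d (x i1) (x i2) (x (n1 + j1)) (x (n1 + j2))
      = ?K i1 i2 + ?K (n1 + j1) (n1 + j2) - ?K i1 (n1 + j2) - ?K i2 (n1 + j1)"
      by (simp only: h_ts_def g_multi_eq)
  qed
  also have "\<dots> = b * (b - 1) * F + a * (a - 1) * H - 2 * (a - 1) * (b - 1) * W"
    by (subst sum_four_fold) (simp_all add: F_def H_def W_def a_def b_def)
  finally have "U_stat d n1 n2 x (\<lambda>j. x (n1 + j))
    = 1 / (a * (a - 1) * b * (b - 1)) * (b * (b - 1) * F + a * (a - 1) * H - 2 * (a - 1) * (b - 1) * W)"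
    by (simp only: U_stat_def a_def b_def)
  also have "\<dots> = 1 / (a * (a - 1)) * F + 1 / (b * (b - 1)) * H - 2 / (a * b) * W"
    using ab by (simp add: divide_simps)
  also have "\<dots> = collision_form {1..n1 + n2} (two_sample_weight n1 n2) x"
  proof -
    have "collision_form {1..n1 + n2} (two_sample_weight n1 n2) x
      = (\<Sum>i=1..n1. 1 / (a * (a - 1)) * (\<Sum>j\<in>{1..n1} - {i}. ?K i j)
            - 1 / (a * b) * (\<Sum>j=1..n2. ?K i (n1 + j)))
        + (\<Sum>k=1..n2. 1 / (b * (b - 1)) * (\<Sum>j\<in>{1..n2} - {k}. ?K (n1 + k) (n1 + j))
            - 1 / (a * b) * (\<Sum>j=1..n1. ?K (n1 + k) j))"
      unfolding collision_form_def a_def b_def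
        sum_two_samples[where f = "\<lambda>i. \<Sum>j=1..n1 + n2. two_sample_weight n1 n2 i j * ?K i j"]
      by (intro arg_cong2[where f = "(+)"] sum.cong refl row_first_sample row_second_sample)
    also have "\<dots> = 1 / (a * (a - 1)) * F - 1 / (a * b) * W
        + (1 / (b * (b - 1)) * H - 1 / (a * b) * (\<Sum>k=1..n2. \<Sum>j=1..n1. ?K (n1 + k) j))"
      unfolding F_def W_def H_def by (simp only: sum_subtractf sum_distrib_left)
    also have "(\<Sum>k=1..n2. \<Sum>j=1..n1. ?K (n1 + k) j) = W"
      unfolding W_def by (subst sum.swap, intro sum.cong refl) auto
    finally show ?thesis by simp
  qed
  finally show ?thesis .
qed

lemma U_stat_pooled:
  "U_stat d n1 n2 Y Z = U_stat d n1 n2 (pooled n1 Y Z) (\<lambda>j. pooled n1 Y Z (n1 + j))"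
  unfolding U_stat_def by (intro arg_cong2[where f = times] sum.cong refl) (simp_all add: pooled_def)

lemma crit_value_eq_permutation_quantile:
  "crit_value d n1 n2 \<alpha> Y Z = permutation_quantile {1..n1 + n2}
    (\<lambda>x. U_stat d n1 n2 x (\<lambda>j. x (n1 + j))) (1 - \<alpha>) (pooled n1 Y Z)"
  by (simp add: crit_value_def permutation_quantile_def U_perm_def card_permutations o_def)

text \<open>Here \<open>s\<close> and \<open>a\<close> stand for the square roots of
  \<open>b\<close> and \<open>\<alpha>\<close>. In terms of the ratio \<open>v\<close>, the two
  error terms are at most \<open>512 * v\<^sup>2 + 32 * v\<close> and \<open>32 * v\<^sup>2\<close>,
  while \<open>sep\<close> says \<open>v \<le> \<beta> / 256\<close>; the total stays below
  \<open>35 * v\<close>.\<close>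

lemma error_bound_arithmetic:
  fixes m a \<beta> s r S V :: real
  assumes "0 < m" "0 < a" "a \<le> 1" "0 < \<beta>" "\<beta> \<le> 1" "0 \<le> s" "0 \<le> r"
    and sep: "256 * (s * r) \<le> m * (a * \<beta>)"
    and S: "S \<le> 2 * r\<^sup>2" and V: "V \<le> r * s * m"
  shows "4 / m\<^sup>2 * (64 * s\<^sup>2 * S + 8 * V) + 16 * s\<^sup>2 * S / (a\<^sup>2 * m\<^sup>2) \<le> \<beta>"
proof -
  define v where "v = s * r / (a * m)"
  have "0 \<le> v" using assms by (simp add: v_def)
  have v: "v \<le> \<beta> / 256" using assms sep by (simp add: v_def field_simps)
  have "a * v \<le> v" using assms \<open>0 \<le> v\<close> by (simp add: mult_left_le_one_le)
  have sr: "s * r = a * v * m" using assms by (simp add: v_def)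
  have sS: "s\<^sup>2 * S \<le> 2 * (a * v * m)\<^sup>2"
    using mult_left_mono[OF S, of "s\<^sup>2"] unfolding sr[symmetric]
    by (simp add: power_mult_distrib mult.left_commute)
  have "4 / m\<^sup>2 * (64 * s\<^sup>2 * S + 8 * V) \<le> 4 / m\<^sup>2 * (128 * (a * v * m)\<^sup>2 + 8 * (a * v * m * m))"
  proof (rule mult_left_mono)
    have "V \<le> a * v * m * m" using V unfolding sr[symmetric] by (simp add: mult.commute)
    with sS show "64 * s\<^sup>2 * S + 8 * V \<le> 128 * (a * v * m)\<^sup>2 + 8 * (a * v * m * m)" by linarith
  qed simp
  also have "\<dots> = 512 * (a * v)\<^sup>2 + 32 * (a * v)"
    using assms(1) by (simp add: power2_eq_square distrib_left)
  also have "\<dots> \<le> 512 * v\<^sup>2 + 32 * v"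
    using \<open>a * v \<le> v\<close> \<open>0 \<le> v\<close> assms by (intro add_mono mult_left_mono power_mono) auto
  finally have 1: "4 / m\<^sup>2 * (64 * s\<^sup>2 * S + 8 * V) \<le> 512 * v\<^sup>2 + 32 * v" .
  have "16 * s\<^sup>2 * S / (a\<^sup>2 * m\<^sup>2) \<le> 32 * (a * v * m)\<^sup>2 / (a\<^sup>2 * m\<^sup>2)"
  proof (rule divide_right_mono)
    show "16 * s\<^sup>2 * S \<le> 32 * (a * v * m)\<^sup>2" using sS by linarith
  qed simp
  also have "\<dots> = 32 * v\<^sup>2" using assms by (simp add: power_mult_distrib)
  finally have 2: "16 * s\<^sup>2 * S / (a\<^sup>2 * m\<^sup>2) \<le> 32 * v\<^sup>2" .
  have "v\<^sup>2 \<le> v * (1 / 256)"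
    unfolding power2_eq_square using v assms(5) \<open>0 \<le> v\<close> by (intro mult_left_mono) auto
  with 1 2 v show ?thesis using \<open>0 < \<beta>\<close> by linarith
qed

section \<open>The multinomial two-sample model\<close>

locale two_sample =
  fixes d n1 n2 :: nat and pY pZ :: "nat pmf"
  assumes n1: "n1 \<ge> 2" and n2: "n2 \<ge> 2"
    and pY: "set_pmf pY \<subseteq> {1..d}" and pZ: "set_pmf pZ \<subseteq> {1..d}"
begin

definition law :: "nat \<Rightarrow> nat pmf" where
  "law i = (if i \<le> n1 then pY else pZ)"

sublocale weighted_product_pmf "{1..n1 + n2}" 0 law "two_sample_weight n1 n2"
proof -
  interpret centred_weights "{1..n1 + n2}" "two_sample_weight n1 n2"
    using n1 n2 by (rule centred_two_sample_weight)
  show "weighted_product_pmf {1..n1 + n2} law (two_sample_weight n1 n2)"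
    by unfold_locales (use pY pZ in \<open>auto simp: law_def intro: finite_subset\<close>)
qed

lemma set_law: "set_pmf (law i) \<subseteq> {1..d}"
  using pY pZ by (simp add: law_def)

lemma expectation_law:
  "measure_pmf.expectation (law i) f = (\<Sum>k=1..d. pmf (law i) k * (f k :: real))"
  by (subst integral_measure_pmf[of "{1..d}"]) (use set_law[of i] in auto)

text \<open>Pooling turns the pair of samples into a single product law: shift the second sample to
  the positions after \<open>n1\<close> and join the two products over disjoint index sets.\<close>

lemma map_pooled_sample_law:
  "map_pmf (\<lambda>(Y, Z). pooled n1 Y Z) (sample_law n1 n2 (pY, pZ)) = Pi_pmf {1..n1 + n2} 0 law"
proof -
  let ?A = "{1..n1}" and ?B = "{n1 + 1..n1 + n2}"
  let ?PY = "Pi_pmf ?A 0 (\<lambda>_. pY)" and ?PZ = "Pi_pmf {1..n2} 0 (\<lambda>_. pZ)"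
  have "bij_betw (\<lambda>i. i - n1) ?B {1..n2}"
    by (rule bij_betwI[where g = "\<lambda>i. i + n1"]) auto
  \<comment> \<open>Truncated subtraction sends positions up to \<open>n1\<close> to 0, outside
    \<open>{1..n2}\<close>, so the default value is preserved off \<open>?B\<close>.\<close>
  then have B: "Pi_pmf ?B 0 law = map_pmf (\<lambda>Z. Z \<circ> (\<lambda>i. i - n1)) ?PZ"
    by (subst Pi_pmf_bij_betw[symmetric, where A = ?B]) (auto intro!: Pi_pmf_cong simp: law_def)
  have A: "Pi_pmf ?A 0 law = ?PY"
    by (intro Pi_pmf_cong) (auto simp: law_def)
  have I: "{1..n1 + n2} = ?A \<union> ?B" and disj: "?A \<inter> ?B = {}" by auto
  have "Pi_pmf {1..n1 + n2} 0 law = map_pmf (\<lambda>(Y, Z) i. if i \<in> ?A then Y i else Z i)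
      (pair_pmf ?PY (map_pmf (\<lambda>Z. Z \<circ> (\<lambda>i. i - n1)) ?PZ))"
    unfolding I Pi_pmf_union[OF finite_atLeastAtMost finite_atLeastAtMost disj] A B ..
  also have "\<dots> = map_pmf (\<lambda>(Y, Z) i. if i \<in> ?A then Y i else Z (i - n1)) (pair_pmf ?PY ?PZ)"
    unfolding pair_map_pmf2 pmf.map_comp
    by (intro map_pmf_cong refl) (simp add: case_prod_unfold fun_eq_iff)
  also have "\<dots> = map_pmf (\<lambda>(Y, Z). pooled n1 Y Z) (pair_pmf ?PY ?PZ)"
  proof (intro map_pmf_cong refl)
    fix YZ assume "YZ \<in> set_pmf (pair_pmf ?PY ?PZ)"
    \<comment> \<open>The tests \<open>i \<in> {1..n1}\<close> and \<open>i \<le> n1\<close> differ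
      at 0 only, where both samples take the default value.\<close>
    then have "fst YZ 0 = 0" "snd YZ 0 = 0"
      using set_Pi_pmf_subset[of ?A 0 "\<lambda>_. pY"] set_Pi_pmf_subset[of "{1..n2}" 0 "\<lambda>_. pZ"] by auto
    then show "(case YZ of (Y, Z) \<Rightarrow> \<lambda>i. if i \<in> ?A then Y i else Z (i - n1))
      = (case YZ of (Y, Z) \<Rightarrow> pooled n1 Y Z)"
      by (auto simp: pooled_def fun_eq_iff Suc_le_eq split: prod.split)
  qed
  finally show ?thesis by (simp add: sample_law_def)
qed

lemma Pi_law_in_range:
  assumes "x \<in> set_pmf (Pi_pmf {1..n1 + n2} 0 law)" "i \<in> {1..n1 + n2}"
  shows "x i \<in> {1..d}"
  using assms set_law[of i] by (auto simp: set_Pi_pmf PiE_dflt_def)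

abbreviation form :: "(nat \<Rightarrow> nat) \<Rightarrow> real" where
  "form \<equiv> collision_form {1..n1 + n2} (two_sample_weight n1 n2)"

lemma permutation_quantile_U_stat:
  assumes "x \<in> set_pmf (Pi_pmf {1..n1 + n2} 0 law)"
  shows "permutation_quantile {1..n1 + n2} (\<lambda>x. U_stat d n1 n2 x (\<lambda>j. x (n1 + j))) q x
    = permutation_quantile {1..n1 + n2} form q x"
proof -
  have "U_stat d n1 n2 (x \<circ> \<pi>) (\<lambda>j. (x \<circ> \<pi>) (n1 + j)) = form (x \<circ> \<pi>)"
    if "\<pi> permutes {1..n1 + n2}" for \<pi>
  proof (rule U_stat_eq_collision_form[OF n1 n2])
    fix i assume "i \<in> {1..n1 + n2}"
    then have "\<pi> i \<in> {1..n1 + n2}" using that by (simp only: permutes_in_image)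
    then show "(x \<circ> \<pi>) i \<in> {1..d}" using Pi_law_in_range[OF assms] by (simp only: o_apply)
  qed
  then have "(\<Sum>\<pi> | \<pi> permutes {1..n1 + n2}. of_bool (U_stat d n1 n2 (x \<circ> \<pi>) (\<lambda>j. (x \<circ> \<pi>) (n1 + j)) \<le> t))
    = (\<Sum>\<pi> | \<pi> permutes {1..n1 + n2}. of_bool (form (x \<circ> \<pi>) \<le> t) :: real)" for t
    by (intro sum.cong) auto
  then show ?thesis by (simp only: permutation_quantile_def)
qed

text \<open>The relation \<open>R\<close> is left open to serve both rejection and acceptance. The
  statistic and the form agree only on samples with values in \<open>{1..d}\<close>, so the events
  are compared almost surely.\<close>

lemma emeasure_sample_law:
  "emeasure (measure_pmf (sample_law n1 n2 (pY, pZ)))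
      {(Y, Z). R (U_stat d n1 n2 Y Z) (crit_value d n1 n2 \<alpha> Y Z)}
    = ennreal (measure_pmf.prob (Pi_pmf {1..n1 + n2} 0 law)
        {x. R (form x) (permutation_quantile {1..n1 + n2} form (1 - \<alpha>) x)})"
proof -
  let ?T = "\<lambda>x. U_stat d n1 n2 x (\<lambda>j. x (n1 + j))"
  let ?I = "{1..n1 + n2}"
  let ?M = "Pi_pmf ?I 0 law"
  have "{(Y, Z). R (U_stat d n1 n2 Y Z) (crit_value d n1 n2 \<alpha> Y Z)}
    = (\<lambda>(Y, Z). pooled n1 Y Z) -` {x. R (?T x) (permutation_quantile ?I ?T (1 - \<alpha>) x)}"
    unfolding crit_value_eq_permutation_quantile by (auto simp flip: U_stat_pooled)
  then have "emeasure (measure_pmf (sample_law n1 n2 (pY, pZ)))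
      {(Y, Z). R (U_stat d n1 n2 Y Z) (crit_value d n1 n2 \<alpha> Y Z)}
    = emeasure (measure_pmf ?M) {x. R (?T x) (permutation_quantile ?I ?T (1 - \<alpha>) x)}"
    by (simp only: map_pooled_sample_law[symmetric] emeasure_map_pmf)
  also have "\<dots> = emeasure (measure_pmf ?M) {x. R (form x) (permutation_quantile ?I form (1 - \<alpha>) x)}"
  proof (rule emeasure_eq_AE)
    show "AE x in measure_pmf ?M. x \<in> {x. R (?T x) (permutation_quantile ?I ?T (1 - \<alpha>) x)}
      \<longleftrightarrow> x \<in> {x. R (form x) (permutation_quantile ?I form (1 - \<alpha>) x)}"
    proof (rule AE_pmfI)
      fix x assume x: "x \<in> set_pmf ?M"
      have "?T x = form x"
        using x Pi_law_in_range by (intro U_stat_eq_collision_form[OF n1 n2])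
      then show "x \<in> {x. R (?T x) (permutation_quantile ?I ?T (1 - \<alpha>) x)}
        \<longleftrightarrow> x \<in> {x. R (form x) (permutation_quantile ?I form (1 - \<alpha>) x)}"
        using permutation_quantile_U_stat[OF x] by simp
    qed
  qed auto
  finally show ?thesis by (simp add: measure_pmf.emeasure_eq_measure)
qed

lemma pmf_law_square_le: "(\<Sum>k=1..d. (pmf (law i) k)\<^sup>2) \<le> b1 d (pY, pZ)"
  by (simp add: law_def b1_def L2_set_def real_sqrt_pow2 sum_nonneg)

lemma overlap_le_b1: "overlap i j \<le> b1 d (pY, pZ)"
proof -
  have "overlap i j \<le> (\<Sum>k=1..d. ((pmf (law i) k)\<^sup>2 + (pmf (law j) k)\<^sup>2) / 2)"
    unfolding overlap_def expectation_law
  proof (intro sum_mono)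
    fix k
    have "0 \<le> (pmf (law i) k - pmf (law j) k)\<^sup>2" by simp
    then show "pmf (law i) k * pmf (law j) k \<le> ((pmf (law i) k)\<^sup>2 + (pmf (law j) k)\<^sup>2) / 2"
      by (simp add: power2_eq_square algebra_simps)
  qed
  also have "\<dots> \<le> b1 d (pY, pZ)"
    using pmf_law_square_le[of i] pmf_law_square_le[of j]
    by (simp add: sum.distrib flip: sum_divide_distrib)
  finally show ?thesis .
qed

text \<open>The maximum norm is at most the Euclidean norm.\<close>

lemma pmf_law_le_sqrt_b1: "k \<in> {1..d} \<Longrightarrow> pmf (law i) k \<le> sqrt (b1 d (pY, pZ))"
proof (rule real_le_rsqrt)
  assume "k \<in> {1..d}"
  then have "(pmf (law i) k)\<^sup>2 \<le> (\<Sum>k=1..d. (pmf (law i) k)\<^sup>2)"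
    by (intro member_le_sum) auto
  then show "(pmf (law i) k)\<^sup>2 \<le> b1 d (pY, pZ)" using pmf_law_square_le[of i] by linarith
qed

lemma b1_pos: "0 < b1 d (pY, pZ)"
proof -
  obtain k where k: "k \<in> set_pmf pY" using set_pmf_not_empty by fast
  then have "0 < pmf (law 0) k" by (simp add: law_def pmf_positive)
  also have "\<dots> \<le> sqrt (b1 d (pY, pZ))" using k pY by (intro pmf_law_le_sqrt_b1) auto
  finally show ?thesis by simp
qed

text \<open>The \<open>n1 - 1\<close> equal weights within the sample sum to \<open>1 / n1\<close>,
  those across to \<open>- 1 / n1\<close>. The linear part thus scales with the difference of the
  two mass functions and vanishes under the null.\<close>

lemma projection_first:
  assumes "i \<in> {1..n1}"
  shows "projection i y = (pmf pY y - pmf pZ y) / n1"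
proof -
  have "(\<Sum>j\<in>{1..n1} - {i}. pmf (law j) y) = (\<Sum>j\<in>{1..n1} - {i}. pmf pY y)"
    "(\<Sum>j=1..n2. pmf (law (n1 + j)) y) = (\<Sum>j=1..n2. pmf pZ y)"
    by (auto intro!: sum.cong simp: law_def)
  then show ?thesis
    unfolding projection_def row_first_sample[OF assms]
    using assms n1 n2 by (simp add: of_nat_diff diff_divide_distrib)
qed

lemma projection_second:
  assumes "k \<in> {1..n2}"
  shows "projection (n1 + k) y = (pmf pZ y - pmf pY y) / n2"
proof -
  have "(\<Sum>j\<in>{1..n2} - {k}. pmf (law (n1 + j)) y) = (\<Sum>j\<in>{1..n2} - {k}. pmf pZ y)"
    "(\<Sum>j=1..n1. pmf (law j) y) = (\<Sum>j=1..n1. pmf pY y)"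
    by (auto intro!: sum.cong simp: law_def)
  then show ?thesis
    unfolding projection_def row_second_sample[OF assms]
    using assms n1 n2 by (simp add: of_nat_diff diff_divide_distrib)
qed

text \<open>Taking \<open>h\<close> to be the identity yields the mean of the form, and taking the
  square yields the linear part of its variance.\<close>

lemma sum_expectation_projection:
  fixes h :: "real \<Rightarrow> real"
  shows "(\<Sum>i=1..n1 + n2. measure_pmf.expectation (law i) (\<lambda>y. h (projection i y)))
    = n1 * (\<Sum>k=1..d. pmf pY k * h ((pmf pY k - pmf pZ k) / n1))
      + n2 * (\<Sum>k=1..d. pmf pZ k * h ((pmf pZ k - pmf pY k) / n2))"
proof -
  have "(\<Sum>i=1..n1. measure_pmf.expectation (law i) (\<lambda>y. h (projection i y)))
    = (\<Sum>i=1..n1. \<Sum>k=1..d. pmf pY k * h ((pmf pY k - pmf pZ k) / n1))"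
    by (intro sum.cong refl) (simp only: expectation_law projection_first, simp add: law_def)
  moreover have "(\<Sum>j=1..n2. measure_pmf.expectation (law (n1 + j)) (\<lambda>y. h (projection (n1 + j) y)))
    = (\<Sum>j=1..n2. \<Sum>k=1..d. pmf pZ k * h ((pmf pZ k - pmf pY k) / n2))"
    by (intro sum.cong refl) (simp only: expectation_law projection_second, simp add: law_def)
  ultimately show ?thesis unfolding sum_two_samples by simp
qed

lemma l2_dist_square: "(l2_dist d (pY, pZ))\<^sup>2 = (\<Sum>k=1..d. (pmf pY k - pmf pZ k)\<^sup>2)"
  by (simp add: l2_dist_def L2_set_def sum_nonneg)

lemma mean_form_eq: "mean_form = (l2_dist d (pY, pZ))\<^sup>2"
proof -
  have "mean_form = (\<Sum>i=1..n1 + n2. measure_pmf.expectation (law i) (\<lambda>y. projection i y))"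
    unfolding mean_form_def by (intro sum.cong refl expectation_projection[symmetric])
  also have "\<dots> = (\<Sum>k=1..d. pmf pY k * (pmf pY k - pmf pZ k)) + (\<Sum>k=1..d. pmf pZ k * (pmf pZ k - pmf pY k))"
    using sum_expectation_projection[of "\<lambda>u. u"] n1 n2
    by (simp flip: sum_divide_distrib)
  also have "\<dots> = (l2_dist d (pY, pZ))\<^sup>2"
    unfolding l2_dist_square sum.distrib[symmetric]
    by (intro sum.cong refl) (simp add: power2_eq_square algebra_simps)
  finally show ?thesis .
qed

text \<open>One mass function is bounded uniformly by the square root of \<open>b1\<close>, and what
  remains is the squared distance. The sample size \<open>n\<close> against the squared scale
  \<open>1 / n\<close> leaves one factor \<open>1 / n\<close>.\<close>

lemma sum_projection_square_le:
  "(\<Sum>i=1..n1 + n2. measure_pmf.expectation (law i) (\<lambda>y. (projection i y)\<^sup>2))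
    \<le> (1 / n1 + 1 / n2) * sqrt (b1 d (pY, pZ)) * (l2_dist d (pY, pZ))\<^sup>2"
proof -
  define s where "s = sqrt (b1 d (pY, pZ))"
  define D where "D = (\<Sum>k=1..d. (pmf pY k - pmf pZ k)\<^sup>2)"
  have le: "(\<Sum>k=1..d. pmf q k * (pmf pY k - pmf pZ k)\<^sup>2) \<le> s * D" if "q \<in> {pY, pZ}" for q
    unfolding D_def sum_distrib_left
  proof (intro sum_mono mult_right_mono)
    fix k assume "k \<in> {1..d}"
    then show "pmf q k \<le> s"
      using that pmf_law_le_sqrt_b1[of k 0] pmf_law_le_sqrt_b1[of k "Suc n1"] by (auto simp: law_def s_def)
  qed simp
  have scale: "real n * (\<Sum>k=1..d. f k * (g k / real n)\<^sup>2) = 1 / real n * (\<Sum>k=1..d. f k * (g k)\<^sup>2)"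
    if "n \<ge> 2" for n and f g :: "nat \<Rightarrow> real"
    unfolding sum_distrib_left using that
    by (intro sum.cong refl) (simp add: power2_eq_square field_simps)
  have "(\<Sum>i=1..n1 + n2. measure_pmf.expectation (law i) (\<lambda>y. (projection i y)\<^sup>2))
    = 1 / n1 * (\<Sum>k=1..d. pmf pY k * (pmf pY k - pmf pZ k)\<^sup>2)
      + 1 / n2 * (\<Sum>k=1..d. pmf pZ k * (pmf pZ k - pmf pY k)\<^sup>2)"
    using sum_expectation_projection[of "\<lambda>u. u\<^sup>2"] by (simp only: scale[OF n1] scale[OF n2])
  also have "(\<Sum>k=1..d. pmf pZ k * (pmf pZ k - pmf pY k)\<^sup>2) = (\<Sum>k=1..d. pmf pZ k * (pmf pY k - pmf pZ k)\<^sup>2)"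
    by (simp add: power2_commute)
  also have "1 / n1 * (\<Sum>k=1..d. pmf pY k * (pmf pY k - pmf pZ k)\<^sup>2) + 1 / n2 * \<dots>
    \<le> 1 / n1 * (s * D) + 1 / n2 * (s * D)"
    using le by (intro add_mono mult_left_mono) auto
  also have "\<dots> = (1 / n1 + 1 / n2) * s * D" by (simp add: algebra_simps)
  finally show ?thesis by (simp add: l2_dist_square s_def D_def)
qed

lemma type_I_error:
  assumes "pY = pZ" "0 < \<alpha>"
  shows "emeasure (measure_pmf (sample_law n1 n2 (pY, pZ)))
    {(Y, Z). U_stat d n1 n2 Y Z > crit_value d n1 n2 \<alpha> Y Z} \<le> ennreal \<alpha>"
proof -
  have "measure_pmf.prob (Pi_pmf {1..n1 + n2} 0 law)
      {x. permutation_quantile {1..n1 + n2} form (1 - \<alpha>) x < form x} \<le> \<alpha>"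
  proof (rule permutation_test_level)
    show "law i = pY" for i unfolding law_def using assms(1) by simp
  qed fact
  then show ?thesis
    unfolding emeasure_sample_law[where R = "\<lambda>u c. c < u"] using assms(2) by (intro ennreal_leI)
qed

lemma type_II_error:
  assumes \<alpha>: "0 < \<alpha>" "\<alpha> < 1" and \<beta>: "0 < \<beta>" "\<beta> \<le> 1"
    and separation: "16 * (b1 d (pY, pZ) powr (1/4) / (\<alpha> powr (1/4) * \<beta> powr (1/2)))
      * (1 / real n1 + 1 / real n2) powr (1/2) \<le> l2_dist d (pY, pZ)"
  shows "emeasure (measure_pmf (sample_law n1 n2 (pY, pZ)))
    {(Y, Z). U_stat d n1 n2 Y Z \<le> crit_value d n1 n2 \<alpha> Y Z} \<le> ennreal \<beta>"
proof -
  define b where "b = b1 d (pY, pZ)"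
  define r where "r = 1 / real n1 + 1 / real n2"
  have "0 < b" using b1_pos by (simp add: b_def)
  have "0 < r" using n1 n2 by (simp add: r_def add_pos_pos)
  define D where "D = 16 * (b powr (1/4) / (\<alpha> powr (1/4) * \<beta> powr (1/2))) * r powr (1/2)"
  have "0 < D" using \<open>0 < b\<close> \<open>0 < r\<close> \<alpha> \<beta> by (simp add: D_def)
  have "D \<le> l2_dist d (pY, pZ)" using separation by (simp add: D_def b_def r_def)
  then have m: "D\<^sup>2 \<le> mean_form" "0 < mean_form"
    using \<open>0 < D\<close> unfolding mean_form_eq by (auto intro: power_mono)
  \<comment> \<open>Squaring turns the separation of the distance into one of
    \<open>mean_form\<close>, and \<open>16\<^sup>2 = 256\<close> is the constant of
    \<open>error_bound_arithmetic\<close>.\<close>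
  have "D\<^sup>2 = 256 * (sqrt b * r) / (sqrt \<alpha> * \<beta>)"
  proof -
    have "(u powr (1/4))\<^sup>2 = sqrt u" "(u powr (1/2))\<^sup>2 = u" if "0 < u" for u :: real
      using that by (simp_all add: powr_power powr_half_sqrt[symmetric])
    then show ?thesis
      using \<open>0 < b\<close> \<open>0 < r\<close> \<alpha> \<beta> unfolding D_def by (simp add: power_mult_distrib power_divide)
  qed
  then have sep: "256 * (sqrt b * r) \<le> mean_form * (sqrt \<alpha> * \<beta>)"
  proof -
    have "256 * (sqrt b * r) = D\<^sup>2 * (sqrt \<alpha> * \<beta>)"
      using \<open>D\<^sup>2 = _\<close> \<alpha> \<beta> by simp
    also have "\<dots> \<le> mean_form * (sqrt \<alpha> * \<beta>)"
      using m(1) \<alpha> \<beta> by (intro mult_right_mono) auto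
    finally show ?thesis .
  qed
  let ?S = "\<Sum>i=1..n1 + n2. \<Sum>j=1..n1 + n2. (two_sample_weight n1 n2 i j)\<^sup>2"
  let ?V = "\<Sum>i=1..n1 + n2. measure_pmf.expectation (law i) (\<lambda>y. (projection i y)\<^sup>2)"
  have "measure_pmf.prob (Pi_pmf {1..n1 + n2} 0 law)
      {x. form x \<le> permutation_quantile {1..n1 + n2} form (1 - \<alpha>) x}
    \<le> 4 / mean_form\<^sup>2 * (64 * b * ?S + 8 * ?V) + 16 * b * ?S / (\<alpha> * mean_form\<^sup>2)"
    using n1 n2 \<alpha> m(2) overlap_le_b1 unfolding b_def by (intro permutation_test_type_II) auto
  also have "\<dots> = 4 / mean_form\<^sup>2 * (64 * (sqrt b)\<^sup>2 * ?S + 8 * ?V)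
      + 16 * (sqrt b)\<^sup>2 * ?S / ((sqrt \<alpha>)\<^sup>2 * mean_form\<^sup>2)"
    using \<open>0 < b\<close> \<alpha> by simp
  also have "\<dots> \<le> \<beta>"
  proof (rule error_bound_arithmetic[OF m(2) _ _ \<beta> _ _ sep])
    show "?S \<le> 2 * r\<^sup>2" unfolding r_def by (rule sum_square_two_sample_weight_le[OF n1 n2])
    show "?V \<le> r * sqrt b * mean_form"
      using sum_projection_square_le by (simp only: r_def b_def mean_form_eq)
  qed (use \<open>0 < b\<close> \<open>0 < r\<close> \<alpha> in auto)
  finally show ?thesis
    unfolding emeasure_sample_law[where R = "\<lambda>u c. u \<le> c"] by (intro ennreal_leI)
qed

end

section \<open>Uniform error bounds over both classes\<close>

theorem proposition4p3:
  "\<exists>C>0. \<forall>(d::nat) (n1::nat) (n2::nat) (\<alpha>::real) (\<beta>::real) (\<epsilon> :: real \<Rightarrow> real).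
     d \<ge> 1 \<longrightarrow> n1 \<ge> 2 \<longrightarrow> n2 \<ge> 2 \<longrightarrow> 0 < \<alpha> \<longrightarrow> \<alpha> < 1 \<longrightarrow> 0 < \<beta> \<longrightarrow> \<beta> < 1 - \<alpha> \<longrightarrow>
     (\<forall>P\<in>multi_pairs d.
        \<epsilon> (b1 d P) \<ge> C * (b1 d P powr (1/4) / (\<alpha> powr (1/4) * \<beta> powr (1/2))) *
                      (1 / real n1 + 1 / real n2) powr (1/2)) \<longrightarrow>
     (SUP P\<in>null_class d. emeasure (measure_pmf (sample_law n1 n2 P))
        {(Y, Z). U_stat d n1 n2 Y Z > crit_value d n1 n2 \<alpha> Y Z}) \<le> ennreal \<alpha> \<and>
     (SUP P\<in>alt_class d \<epsilon>. emeasure (measure_pmf (sample_law n1 n2 P))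
        {(Y, Z). U_stat d n1 n2 Y Z \<le> crit_value d n1 n2 \<alpha> Y Z}) \<le> ennreal \<beta>"
\<comment> \<open>The universal constant is the one in \<open>type_II_error\<close>.\<close>
proof (intro exI[of _ 16] conjI allI impI SUP_least)
  fix d n1 n2 :: nat and \<alpha> \<beta> :: real and \<epsilon> :: "real \<Rightarrow> real" and P
  assume n: "n1 \<ge> 2" "n2 \<ge> 2" and \<alpha>: "0 < \<alpha>" "\<alpha> < 1" and "P \<in> null_class d"
  then obtain pY where P: "P = (pY, pY)" "set_pmf pY \<subseteq> {1..d}"
    by (cases P) (auto simp: null_class_def multi_pairs_def)
  interpret two_sample d n1 n2 pY pY by unfold_locales (use n P in auto)
  show "emeasure (measure_pmf (sample_law n1 n2 P))
      {(Y, Z). U_stat d n1 n2 Y Z > crit_value d n1 n2 \<alpha> Y Z} \<le> ennreal \<alpha>"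
    unfolding P using \<alpha> by (intro type_I_error refl)
next
  fix d n1 n2 :: nat and \<alpha> \<beta> :: real and \<epsilon> :: "real \<Rightarrow> real" and P
  assume n: "n1 \<ge> 2" "n2 \<ge> 2" and \<alpha>: "0 < \<alpha>" "\<alpha> < 1" and \<beta>: "0 < \<beta>" "\<beta> < 1 - \<alpha>"
    and \<epsilon>: "\<forall>P\<in>multi_pairs d.
        \<epsilon> (b1 d P) \<ge> 16 * (b1 d P powr (1/4) / (\<alpha> powr (1/4) * \<beta> powr (1/2))) *
                      (1 / real n1 + 1 / real n2) powr (1/2)"
    and "P \<in> alt_class d \<epsilon>"
  then obtain pY pZ where P: "P = (pY, pZ)" "set_pmf pY \<subseteq> {1..d}" "set_pmf pZ \<subseteq> {1..d}"
      and multi: "P \<in> multi_pairs d" and dist: "\<epsilon> (b1 d P) \<le> l2_dist d P"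
    by (cases P) (auto simp: alt_class_def multi_pairs_def)
  interpret two_sample d n1 n2 pY pZ by unfold_locales (use n P in auto)
  have "16 * (b1 d P powr (1/4) / (\<alpha> powr (1/4) * \<beta> powr (1/2))) *
      (1 / real n1 + 1 / real n2) powr (1/2) \<le> l2_dist d P"
    using \<epsilon> multi dist by (meson order_trans)
  then show "emeasure (measure_pmf (sample_law n1 n2 P))
      {(Y, Z). U_stat d n1 n2 Y Z \<le> crit_value d n1 n2 \<alpha> Y Z} \<le> ennreal \<beta>"
    unfolding P using \<alpha> \<beta> by (intro type_II_error) auto
qed simp

end
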